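(* Let $P$ be an ordinary point that does not lie on the extended sides of triangle $ABC$ or of its anticomplementary triangle, does not lie on a median of $ABC$, and whose isotomic conjugate $P'$ is ordinary. Let $Z$ be the center of the conic $\mathcal{C}_P$. (a) $Z=GV\cdot G_1J$, where $G_1=T_P(G)$ is the centroid of the cevian triangle $DEF$ of $P$ and $J$ is the midpoint of segment $PQ$. (b) The lines $GV$, $T_P(GV)=G_1J$, and $T_{P'}(GV)=G_2J'=\eta(G_1J)$ are concurrent at $Z$, where $G_2=T_{P'}(G)$ and $J'$ is the midpoint of $P'Q'$.
   Context: Work in the extended Euclidean plane: the Euclidean plane together with the line at infinity $l_\infty$. Points on $l_\infty$ are called infinite, all other points ordinary; affine maps are extended to $l_\infty$. $XY$ denotes the line through $X$ and $Y$, and $l\cdot m$ the intersection point of lines $l$ and $m$. $ABC$ is a (nondegenerate) triangle with centroid $G$; medians are the full lines $AG,BG,CG$. $K$ is the homothety with center $G$ and ratio $-1/2$; the anticomplementary triangle is $K^{-1}(ABC)$. $D=AP\cdot BC$, $E=BP\cdot CA$, $F=CP\cdot AB$ are the traces of $P$, and $D_3,E_3,F_3$ are their reflections in the midpoints of $BC,CA,AB$ respectively; the lines $AD_3,BE_3,CF_3$ meet in the isotomic conjugate $P'$ of $P$. Put $Q=K(P')$, $Q'=K(P)$, $V=PQ\cdot P'Q'$, and $V_\infty=PP'\cdot QQ'$ (an infinite point, since $PP'\parallel QQ'$). $T_P$ is the unique affine map with $A\mapsto D$, $B\mapsto E$, $C\mapsto F$; $T_{P'}$ is the unique affine map with $A\mapsto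 D_3$, $B\mapsto E_3$, $C\mapsto F_3$. $\eta$ is the harmonic homology with center $V_\infty$ and axis $GV$: the affine reflection that fixes $GV$ pointwise and maps each ordinary point $Y\notin GV$ to the point $Y'$ such that $YY'\parallel PP'$ and the midpoint of $YY'$ lies on $GV$. $\mathcal{C}_P$ is the (nondegenerate) conic through $A,B,C,P,Q$; it also passes through $P'$ and $Q'$. The center of a conic is the pole of $l_\infty$ with respect to the conic. *)

theory Defs
  imports "HOL-Analysis.Analysis"
begin

text \<open>The extended Euclidean plane in homogeneous coordinates: a point is a one-dimensional
  subspace of $\mathbb{R}^3$. The ordinary point $(x_1,x_2)$ is spanned by $(x_1,x_2,1)$, and the
  infinite point in direction $(u_1,u_2)$ is spanned by $(u_1,u_2,0)$.\<close>

typedef xpoint = "{L :: (real^3) set. subspace L \<and> dim L = 1}"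
proof
  show "span {axis 1 1 :: real^3} \<in> {L. subspace L \<and> dim L = 1}"
    by (simp add: axis_eq_0_iff)
qed

definition hvec :: "real^2 \<Rightarrow> real \<Rightarrow> real^3" where
  "hvec x w = vector [x $ 1, x $ 2, w]"

definition pt :: "real^2 \<Rightarrow> xpoint" where
  "pt x = Abs_xpoint (span {hvec x 1})"

definition line_infty :: "xpoint set" where
  "line_infty = {X. \<forall>v \<in> Rep_xpoint X. v $ 3 = 0}"

definition ordinary :: "xpoint \<Rightarrow> bool" where
  "ordinary X \<longleftrightarrow> X \<notin> line_infty"

text \<open>Inverse of \<^term>\<open>pt\<close>; meaningful for ordinary points only.\<close>

definition coords :: "xpoint \<Rightarrow> real^2" where
  "coords X = (THE x. pt x = X)"

definition is_line :: "xpoint set \<Rightarrow> bool" where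
  "is_line l \<longleftrightarrow> (\<exists>w. w \<noteq> 0 \<and> l = {X. \<forall>v \<in> Rep_xpoint X. w \<bullet> v = 0})"

definition join :: "xpoint \<Rightarrow> xpoint \<Rightarrow> xpoint set" where
  "join X Y = (THE l. is_line l \<and> X \<in> l \<and> Y \<in> l)"

definition meet :: "xpoint set \<Rightarrow> xpoint set \<Rightarrow> xpoint" where
  "meet l m = (THE X. l \<inter> m = {X})"

definition affine_map :: "(real^2 \<Rightarrow> real^2) \<Rightarrow> bool" where
  "affine_map f \<longleftrightarrow> (\<exists>L b. linear L \<and> f = (\<lambda>x. L x + b))"

text \<open>If $f(x) = Lx + b$, then \<^term>\<open>homogenize f\<close> is the linear map
  $(u,w) \mapsto (Lu + wb, w)$; here $b = f(0)$ and $Lu = f(u) - f(0)$.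
  The extension \<^term>\<open>xmap f\<close> of $f$ to the extended plane is meaningful on all points when $f$
  is an affine bijection, and on ordinary points when $f$ is any affine map.\<close>

definition homogenize :: "(real^2 \<Rightarrow> real^2) \<Rightarrow> real^3 \<Rightarrow> real^3" where
  "homogenize f v = hvec (f (vector [v $ 1, v $ 2]) - f 0 + v $ 3 *\<^sub>R f 0) (v $ 3)"

definition xmap :: "(real^2 \<Rightarrow> real^2) \<Rightarrow> xpoint \<Rightarrow> xpoint" where
  "xmap f X = Abs_xpoint (homogenize f ` Rep_xpoint X)"

definition xmidpoint :: "xpoint \<Rightarrow> xpoint \<Rightarrow> xpoint" where
  "xmidpoint X Y = pt (midpoint (coords X) (coords Y))"

definition centroid :: "xpoint \<Rightarrow> xpoint \<Rightarrow> xpoint \<Rightarrow> xpoint" where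
  "centroid A B C = pt ((1/3) *\<^sub>R (coords A + coords B + coords C))"

definition homothety :: "xpoint \<Rightarrow> real \<Rightarrow> xpoint \<Rightarrow> xpoint" where
  "homothety X k = xmap (\<lambda>x. coords X + k *\<^sub>R (x - coords X))"

definition point_reflection :: "xpoint \<Rightarrow> xpoint \<Rightarrow> xpoint" where
  "point_reflection M = homothety M (- 1)"

text \<open>The affine map taking the ordinary points $A, B, C$ to $D, E, F$.\<close>

definition affine_taking ::
  "xpoint \<Rightarrow> xpoint \<Rightarrow> xpoint \<Rightarrow> xpoint \<Rightarrow> xpoint \<Rightarrow> xpoint \<Rightarrow> xpoint \<Rightarrow> xpoint" where
  "affine_taking A B C D E F =
     xmap (THE f. affine_map f \<and> xmap f A = D \<and> xmap f B = E \<and> xmap f C = F)"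

text \<open>The trace on the side $BC$ of the cevian from $A$ through $P$, and its reflection in the
  midpoint of $BC$.\<close>

definition cevian_trace :: "xpoint \<Rightarrow> xpoint \<Rightarrow> xpoint \<Rightarrow> xpoint \<Rightarrow> xpoint" where
  "cevian_trace A P B C = meet (join A P) (join B C)"

definition isotomic_trace :: "xpoint \<Rightarrow> xpoint \<Rightarrow> xpoint \<Rightarrow> xpoint \<Rightarrow> xpoint" where
  "isotomic_trace A P B C = point_reflection (xmidpoint B C) (cevian_trace A P B C)"

definition isotomic_conjugate :: "xpoint \<Rightarrow> xpoint \<Rightarrow> xpoint \<Rightarrow> xpoint \<Rightarrow> xpoint" where
  "isotomic_conjugate A B C P =
     (THE X. X \<in> join A (isotomic_trace A P B C) \<and>
             X \<in> join B (isotomic_trace B P C A) \<and>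
             X \<in> join C (isotomic_trace C P A B))"

text \<open>Harmonic homology with an infinite center $U$ and an axis $a$ not through $U$, i.e. an affine
  reflection: for ordinary $Y$ off the axis, $Y$ and its image $Y'$ lie on a line in the direction
  $U$, and the midpoint of $YY'$ is on the axis.\<close>

definition affine_reflection :: "xpoint \<Rightarrow> xpoint set \<Rightarrow> xpoint \<Rightarrow> xpoint" where
  "affine_reflection U a =
     xmap (THE f. affine_map f \<and>
       (\<forall>y. pt y \<in> a \<longrightarrow> f y = y) \<and>
       (\<forall>y. pt y \<notin> a \<longrightarrow> U \<in> join (pt y) (pt (f y)) \<and> pt (midpoint y (f y)) \<in> a))"

text \<open>A nondegenerate conic is the nonempty zero set of a nondegenerate quadratic form.\<close>

definition conic_of :: "real^3^3 \<Rightarrow> xpoint set" where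
  "conic_of M = {X. \<forall>v \<in> Rep_xpoint X. v \<bullet> (M *v v) = 0}"

definition nondegenerate_form :: "real^3^3 \<Rightarrow> bool" where
  "nondegenerate_form M \<longleftrightarrow> transpose M = M \<and> det M \<noteq> 0"

definition nondegenerate_conic :: "xpoint set \<Rightarrow> bool" where
  "nondegenerate_conic S \<longleftrightarrow> S \<noteq> {} \<and> (\<exists>M. nondegenerate_form M \<and> S = conic_of M)"

definition polar :: "real^3^3 \<Rightarrow> xpoint \<Rightarrow> xpoint set" where
  "polar M X = {Y. \<forall>v \<in> Rep_xpoint X. \<forall>w \<in> Rep_xpoint Y. v \<bullet> (M *v w) = 0}"

text \<open>The form of a nondegenerate conic (with real points) is determined up to a nonzero scalar,
  so the pole does not depend on its choice.\<close>

definition pole :: "xpoint set \<Rightarrow> xpoint set \<Rightarrow> xpoint" where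
  "pole S l = (THE X. \<exists>M. nondegenerate_form M \<and> S = conic_of M \<and> polar M X = l)"

definition conic_center :: "xpoint set \<Rightarrow> xpoint" where
  "conic_center S = pole S line_infty"

definition conic_through ::
  "xpoint \<Rightarrow> xpoint \<Rightarrow> xpoint \<Rightarrow> xpoint \<Rightarrow> xpoint \<Rightarrow> xpoint set" where
  "conic_through A B C P Q = (THE S. nondegenerate_conic S \<and> {A, B, C, P, Q} \<subseteq> S)"

lemma hvec_nth [simp]: "hvec x w $ 1 = x $ 1" "hvec x w $ 2 = x $ 2" "hvec x w $ 3 = w"
  by (simp_all add: hvec_def)

lemma Rep_pt: "Rep_xpoint (pt x) = span {hvec x 1}"
proof -
  have "hvec x 1 \<noteq> 0" by (metis hvec_nth(3) zero_index zero_neq_one)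
  then show ?thesis by (simp add: pt_def Abs_xpoint_inverse)
qed

lemma pt_eq_iff [simp]: "pt x = pt y \<longleftrightarrow> x = y"
proof
  assume "pt x = pt y"
  then have "hvec x 1 \<in> span {hvec y 1}" by (metis Rep_pt insertI1 span_base)
  then obtain k where k: "hvec x 1 = k *\<^sub>R hvec y 1" by (auto simp: span_singleton)
  have "k = 1" using arg_cong[OF k, of "\<lambda>v. v $ 3"] by simp
  with k have "hvec x 1 = hvec y 1" by simp
  then have "x $ 1 = y $ 1" "x $ 2 = y $ 2" by (metis hvec_nth(1), metis hvec_nth(2))
  then show "x = y" by (simp add: vec_eq_iff forall_2)
qed simp

lemma coords_pt [simp]: "coords (pt x) = x"
  by (simp add: coords_def)

lemma ordinary_iff: "ordinary X \<longleftrightarrow> (\<exists>x. X = pt x)"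
proof
  assume "ordinary X"
  then obtain v where v: "v \<in> Rep_xpoint X" "v $ 3 \<noteq> 0"
    by (auto simp: ordinary_def line_infty_def)
  define x :: "real^2" where "x = vector [v $ 1 / v $ 3, v $ 2 / v $ 3]"
  have S: "subspace (Rep_xpoint X)" "dim (Rep_xpoint X) = 1" using Rep_xpoint[of X] by auto
  have h: "hvec x 1 = (1 / v $ 3) *\<^sub>R v"
    using v(2) by (simp add: vec_eq_iff forall_3 x_def)
  then have "hvec x 1 \<in> Rep_xpoint X" using v S(1) by (simp add: subspace_scale)
  then have sub: "span {hvec x 1} \<subseteq> Rep_xpoint X" using S(1) by (simp add: span_minimal)
  have "hvec x 1 \<noteq> 0" by (metis hvec_nth(3) zero_index zero_neq_one)
  then have "span {hvec x 1} = Rep_xpoint X"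
    using subspace_dim_equal[OF subspace_span S(1) sub] S(2) by simp
  then have "X = pt x" by (metis Rep_pt Rep_xpoint_inject)
  then show "\<exists>x. X = pt x" ..
next
  assume "\<exists>x. X = pt x"
  then obtain x where "X = pt x" ..
  then have "hvec x 1 \<in> Rep_xpoint X" by (simp add: Rep_pt span_base)
  then show "ordinary X" by (force simp: ordinary_def line_infty_def)
qed

lemma xmap_pt:
  assumes "affine_map f"
  shows "xmap f (pt x) = pt (f x)"
proof -
  obtain L b where L: "linear L" and f: "f = (\<lambda>x. L x + b)"
    using assms by (auto simp: affine_map_def)
  have "homogenize f (k *\<^sub>R hvec x 1) = k *\<^sub>R hvec (f x) 1" for k
  proof -
    have v: "vector [k * x $ 1, k * x $ 2] = k *\<^sub>R x" by (simp add: vec_eq_iff forall_2)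
    show ?thesis
      using L by (simp add: homogenize_def f v linear_0 linear_cmul)
        (simp add: vec_eq_iff forall_3 algebra_simps)
  qed
  then have "homogenize f ` span {hvec x 1} = span {hvec (f x) 1}"
    by (auto simp: span_singleton image_iff)
  then show ?thesis by (simp add: xmap_def Rep_pt) (simp add: pt_def)
qed

end

theory Submission
  imports Defs
begin

text \<open>
  In barycentric coordinates with respect to \<open>ABC\<close> every object of the theorem has an explicit
  vector. Let \<open>P = (x : y : z)\<close> and write \<open>s = x + y + z\<close>, \<open>q = xy + yz + zx\<close>,
  \<open>\<Pi> = (y + z)(z + x)(x + y)\<close>, \<open>\<Delta> = (x - y)(y - z)(z - x)\<close>. Giving the first coordinate only (the other
  two arise by rotating \<open>x, y, z\<close>), the points are \<open>P' = yz\<close>, \<open>Q = x(y + z)\<close>, \<open>Q' = y + z\<close>,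
  \<open>V = x(y\<^sup>2 + yz + z\<^sup>2)\<close>, \<open>G\<^sub>1 = x(y + z)(2x + y + z)\<close>, \<open>J = x(2q + s(y + z))\<close>, and the line \<open>GV\<close> has the
  coefficient vector \<open>l = (y - z)(x\<^sup>2 - yz)\<close>.

  The conic through \<open>A, B, C, P, Q\<close> is \<open>x(y\<^sup>2 - z\<^sup>2) vw + y(z\<^sup>2 - x\<^sup>2) wu + z(x\<^sup>2 - y\<^sup>2) uv = 0\<close>, and the pole of
  the line at infinity \<open>u + v + w = 0\<close> is \<open>Z = x(y - z)\<^sup>2\<close>. Now \<open>Z = V - 3xyz G\<close> as vectors (lemma
  \<open>Z_eq_V_G\<close>) puts \<open>Z\<close> on \<open>GV\<close>, and \<open>Z = 3 G\<^sub>1 - 2 J\<close> (lemma \<open>Z_eq_G1_J\<close>) puts it on \<open>G\<^sub>1J\<close>. These two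
  lines are distinct because \<open>l \<bullet> G\<^sub>1 = -2 \<Delta> s q\<close> is nonzero: \<open>\<Delta>\<close> because \<open>P\<close> lies on no median,
  \<open>s\<close> because \<open>P\<close> is ordinary, and \<open>q\<close> because \<open>P'\<close> is. The cevian map \<open>T\<^sub>P\<close>, scaled by \<open>\<Pi>\<close>,
  sends \<open>G\<close> to \<open>G\<^sub>1\<close> and \<open>V\<close> to \<open>\<Pi> J - s q G\<^sub>1\<close> (lemma \<open>cevian_map_V\<close>), hence \<open>GV\<close> to \<open>G\<^sub>1J\<close>.

  Exchanging \<open>P\<close> and \<open>P'\<close> means replacing \<open>(x, y, z)\<close> by \<open>(yz, zx, xy)\<close>. This multiplies the vectors
  of \<open>V\<close>, of \<open>Z\<close> and of the line \<open>GV\<close> by \<open>xyz\<close>, so these objects stay the same, and the statements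
  about \<open>G\<^sub>1\<close>, \<open>J\<close>, \<open>T\<^sub>P\<close> become statements about \<open>G\<^sub>2\<close>, \<open>J'\<close>, \<open>T\<^sub>P\<^sub>'\<close>. Moreover \<open>G\<^sub>2 = G\<^sub>1 + 2d\<close>,
  where \<open>d = (y + z)(yz - x\<^sup>2)\<close> is the vector of \<open>V\<^sub>\<infinity>\<close>, and \<open>l \<bullet> d = - l \<bullet> G\<^sub>1\<close>; so the
  midpoint of \<open>G\<^sub>1G\<^sub>2\<close> is on \<open>GV\<close> and \<open>\<eta>\<close> sends \<open>G\<^sub>1\<close> to \<open>G\<^sub>2\<close>. Since it fixes \<open>Z\<close>, it sends the line
  \<open>G\<^sub>1J = G\<^sub>1Z\<close> to \<open>G\<^sub>2Z = G\<^sub>2J'\<close>. Working with coordinate vectors throughout, the argument also covers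
  the case in which \<open>\<C>\<^sub>P\<close> is a parabola and \<open>Z\<close> is infinite.
\<close>

unbundle cross3_syntax

section \<open>Points as vectors in three-space\<close>

definition hpt :: "real^3 \<Rightarrow> xpoint" where
  "hpt v = Abs_xpoint (span {v})"

lemma Rep_hpt: "v \<noteq> 0 \<Longrightarrow> Rep_xpoint (hpt v) = span {v}"
  by (simp add: hpt_def Abs_xpoint_inverse)

lemma hpt_exhaust: obtains v where "v \<noteq> 0" "X = hpt v"
proof -
  have S: "subspace (Rep_xpoint X)" "dim (Rep_xpoint X) = 1" using Rep_xpoint[of X] by auto
  have "Rep_xpoint X \<noteq> {0}" using S(2) by (metis dim_eq_0 subset_refl zero_neq_one)
  then obtain v where v: "v \<in> Rep_xpoint X" "v \<noteq> 0"
    using S(1) subspace_0 by blast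
  have "span {v} = Rep_xpoint X"
    using subspace_dim_equal[OF subspace_span S(1), of "{v}"] v S
    by (simp add: span_minimal)
  then have "X = hpt v" by (metis Rep_hpt Rep_xpoint_inject v(2))
  with v(2) show ?thesis using that by blast
qed

lemma hpt_scale: "k \<noteq> 0 \<Longrightarrow> hpt (k *\<^sub>R v) = hpt v"
proof -
  assume k: "k \<noteq> 0"
  have "range (\<lambda>c. c *\<^sub>R (k *\<^sub>R v)) = range (\<lambda>c. c *\<^sub>R v)"
  proof (intro subset_antisym image_subsetI)
    fix c show "c *\<^sub>R v \<in> range (\<lambda>c. c *\<^sub>R (k *\<^sub>R v))"
      using k by (intro image_eqI[of _ _ "c / k"]) auto
  qed auto
  then have "span {k *\<^sub>R v} = span {v}" by (simp only: span_singleton)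
  then show ?thesis by (simp add: hpt_def)
qed

lemma parallel_if_cross_eq_0:
  fixes u v :: "real^3"
  assumes "u \<times> v = 0" "u \<noteq> 0"
  shows "\<exists>k. v = k *\<^sub>R u"
  using assms cross_eq_0 collinear_lemma by (metis scale_zero_left)

lemma hpt_eq_iff:
  assumes "u \<noteq> 0" "v \<noteq> 0"
  shows "hpt u = hpt v \<longleftrightarrow> u \<times> v = 0"
proof
  assume "hpt u = hpt v"
  then have "v \<in> span {u}" using assms Rep_hpt by (metis insertI1 span_base)
  then show "u \<times> v = 0" by (auto simp: span_singleton cross_mult_right)
next
  assume "u \<times> v = 0"
  then obtain k where "v = k *\<^sub>R u" using parallel_if_cross_eq_0 assms by blast
  then show "hpt u = hpt v" using hpt_scale assms by (metis scale_zero_left)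
qed

lemma pt_eq_hpt: "pt x = hpt (hvec x 1)"
  by (simp add: pt_def hpt_def)

text \<open>The coefficients come from the four-vector identity \<open>cramer\<close> below, taken at \<open>m = u \<times> v\<close>.\<close>

lemma in_span_cross:
  fixes u v w :: "real^3"
  assumes "u \<times> v \<noteq> 0" "(u \<times> v) \<bullet> w = 0"
  shows "\<exists>\<alpha> \<beta>. w = \<alpha> *\<^sub>R u + \<beta> *\<^sub>R v"
proof -
  define n where "n = u \<times> v"
  have n: "n \<bullet> n \<noteq> 0" using assms(1) by (simp add: n_def)
  have cramer: "(m \<bullet> (u \<times> v)) *\<^sub>R w =
      (m \<bullet> (w \<times> v)) *\<^sub>R u + (m \<bullet> (u \<times> w)) *\<^sub>R v + ((u \<times> v) \<bullet> w) *\<^sub>R m" for m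
    by (simp add: cross3_simps forall_3)
  have "(n \<bullet> n) *\<^sub>R w = (n \<bullet> (w \<times> v)) *\<^sub>R u + (n \<bullet> (u \<times> w)) *\<^sub>R v"
    using cramer[of n] assms(2) by (simp add: n_def)
  then have "(1 / (n \<bullet> n)) *\<^sub>R ((n \<bullet> n) *\<^sub>R w) =
    (1 / (n \<bullet> n)) *\<^sub>R ((n \<bullet> (w \<times> v)) *\<^sub>R u + (n \<bullet> (u \<times> w)) *\<^sub>R v)" by simp
  then have "w = (1 / (n \<bullet> n)) *\<^sub>R ((n \<bullet> (w \<times> v)) *\<^sub>R u + (n \<bullet> (u \<times> w)) *\<^sub>R v)"
    using n by simp
  then show ?thesis by (metis scaleR_add_right scaleR_scaleR)
qed

text \<open>The affine map of the plane whose homogenization is a given linear map. It serves to show that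
  the definite descriptions of affine maps in the problem denote something.\<close>

definition dehom :: "(real^3 \<Rightarrow> real^3) \<Rightarrow> real^2 \<Rightarrow> real^2" where
  "dehom L y = vector [L (hvec y 1) $ 1, L (hvec y 1) $ 2]"

lemma
  assumes L: "linear L" "\<And>v. L v $ 3 = v $ 3"
  shows affine_map_dehom: "affine_map (dehom L)"
    and homogenize_dehom: "homogenize (dehom L) = L"
proof -
  have Lv: "L v = v $ 1 *\<^sub>R L (axis 1 1) + v $ 2 *\<^sub>R L (axis 2 1) + v $ 3 *\<^sub>R L (axis 3 1)" for v
  proof -
    have "v = v $ 1 *\<^sub>R axis 1 1 + v $ 2 *\<^sub>R axis 2 1 + v $ 3 *\<^sub>R axis 3 1"
      by (simp add: vec_eq_iff forall_3 axis_def)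
    then have "L v = L (v $ 1 *\<^sub>R axis 1 1 + v $ 2 *\<^sub>R axis 2 1 + v $ 3 *\<^sub>R axis 3 1)" by (rule arg_cong)
    then show ?thesis by (simp only: linear_add[OF L(1)] linear_cmul[OF L(1)])
  qed
  define M where "M y = (vector [(y $ 1 *\<^sub>R L (axis 1 1) + y $ 2 *\<^sub>R L (axis 2 1)) $ 1,
      (y $ 1 *\<^sub>R L (axis 1 1) + y $ 2 *\<^sub>R L (axis 2 1)) $ 2] :: real^2)" for y :: "real^2"
  define b where "b = (vector [L (axis 3 1) $ 1, L (axis 3 1) $ 2] :: real^2)"
  have "linear M"
    by (rule linearI) (simp_all add: M_def vec_eq_iff forall_2 algebra_simps)
  moreover have d: "dehom L = (\<lambda>y. M y + b)"
    by (rule ext) (simp add: dehom_def M_def b_def Lv[of "hvec _ _"] vec_eq_iff forall_2)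
  ultimately show "affine_map (dehom L)" by (auto simp: affine_map_def)
  show "homogenize (dehom L) = L"
  proof
    fix v
    have "homogenize (dehom L) v $ 3 = L v $ 3" by (simp add: homogenize_def L)
    then show "homogenize (dehom L) v = L v"
      by (simp add: vec_eq_iff forall_3 homogenize_def d M_def b_def Lv[of v])
  qed
qed

lemma xmap_hpt:
  assumes "linear (homogenize f)" "v \<noteq> 0"
  shows "xmap f (hpt v) = hpt (homogenize f v)"
  using assms linear_span_image[of "homogenize f" "{v}"]
  by (simp add: xmap_def Rep_hpt) (simp add: hpt_def)

section \<open>Barycentric coordinates\<close>

text \<open>The weight: a barycentric vector represents an ordinary point iff it is nonzero.\<close>

definition wt :: "real^3 \<Rightarrow> real" where
  "wt u = u $ 1 + u $ 2 + u $ 3"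

lemma wt_linear [simp]:
  "wt (u + v) = wt u + wt v" "wt (u - v) = wt u - wt v" "wt (k *\<^sub>R u) = k * wt u"
  "wt (vector [x, y, z]) = x + y + z"
  by (simp_all add: wt_def algebra_simps)

locale triangle_frame =
  fixes a b c :: "real^2"
  assumes noncollinear: "\<not> collinear {a, b, c}"
begin

text \<open>Change of coordinates from barycentric to Cartesian homogeneous ones.\<close>

definition H :: "real^3 \<Rightarrow> real^3" where
  "H u = u $ 1 *\<^sub>R hvec a 1 + u $ 2 *\<^sub>R hvec b 1 + u $ 3 *\<^sub>R hvec c 1"

definition point :: "real^3 \<Rightarrow> xpoint" where
  "point u = hpt (H u)"

definition line :: "real^3 \<Rightarrow> xpoint set" where
  "line m = {point u |u. u \<noteq> 0 \<and> m \<bullet> u = 0}"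

lemma linear_H: "linear H"
  by (rule linearI) (simp_all add: H_def algebra_simps)

lemma H_3: "H u $ 3 = wt u"
  by (simp add: H_def wt_def)

lemma H_eq_0: "H u = 0 \<longleftrightarrow> u = 0"
proof
  assume 0: "H u = 0"
  have w: "u $ 1 = - u $ 2 - u $ 3" using H_3[of u] 0 by (simp add: wt_def)
  have "(H u) $ 1 = 0" "(H u) $ 2 = 0" using 0 by simp_all
  then have dep: "u $ 2 *\<^sub>R (b - a) + u $ 3 *\<^sub>R (c - a) = 0"
    by (simp add: H_def vec_eq_iff forall_2 w algebra_simps)
  have nc: "\<not> collinear {0, b - a, c - a}"
  proof -
    have "{a, b, c} = {b, a, c}" by auto
    then show ?thesis using noncollinear collinear_3[of b a c] by simp
  qed
  have u3: "u $ 3 = 0"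
  proof (rule ccontr)
    assume n: "u $ 3 \<noteq> 0"
    have "u $ 3 *\<^sub>R (c - a) = (- u $ 2) *\<^sub>R (b - a)"
      using dep by (simp add: algebra_simps add_eq_0_iff)
    then have "c - a = (- u $ 2 / u $ 3) *\<^sub>R (b - a)"
      using n by (simp add: vec_eq_iff forall_2 field_simps)
    then show False using nc unfolding collinear_lemma by blast
  qed
  then have "u $ 2 *\<^sub>R (b - a) = 0" using dep by simp
  then have "u $ 2 = 0" using nc by (auto simp: collinear_lemma)
  with u3 w show "u = 0" by (simp add: vec_eq_iff forall_3)
qed (simp add: H_def)

lemma inj_H: "inj H"
  using linear_injective_0[OF linear_H] H_eq_0 by blast

lemma surj_H: "surj H"
  using linear_injective_imp_surjective[OF linear_H inj_H] by simp

lemma inv_H [simp]: "inv H (H u) = u" "H (inv H v) = v"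
  using inj_H surj_H by (simp_all add: surj_f_inv_f)

lemma linear_inv_H: "linear (inv H)"
  using linear_H inj_H inj_linear_imp_inv_linear by blast

lemma H_cross: "H u \<times> H v = 0 \<longleftrightarrow> u \<times> v = 0"
proof (cases "u = 0")
  case False
  have "H u \<times> H v = 0 \<longleftrightarrow> (\<exists>k. H v = k *\<^sub>R H u)"
    using parallel_if_cross_eq_0[of "H u" "H v"] False H_eq_0[of u] cross_mult_right cross_refl scale_zero_right
    by metis
  also have "\<dots> \<longleftrightarrow> (\<exists>k. v = k *\<^sub>R u)"
    using linear_cmul[OF linear_H] inj_H by (metis injD)
  also have "\<dots> \<longleftrightarrow> u \<times> v = 0"
    using parallel_if_cross_eq_0[of u v] False cross_mult_right cross_refl scale_zero_right by metis
  finally show ?thesis .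
qed (simp add: H_def)

lemma point_eq_iff:
  assumes "u \<noteq> 0" "v \<noteq> 0"
  shows "point u = point v \<longleftrightarrow> u \<times> v = 0"
  using assms hpt_eq_iff H_eq_0 H_cross by (simp add: point_def)

lemma point_scale: "k \<noteq> 0 \<Longrightarrow> point (k *\<^sub>R u) = point u"
  using hpt_scale by (simp add: point_def linear_cmul[OF linear_H])

lemma point_exhaust: obtains u where "u \<noteq> 0" "X = point u"
proof -
  obtain v where v: "v \<noteq> 0" "X = hpt v" by (rule hpt_exhaust)
  have "X = point (inv H v)" using v by (simp add: point_def)
  moreover have "inv H v \<noteq> 0" using v H_eq_0 inv_H(2) by metis
  ultimately show ?thesis using that by blast
qed

lemma Rep_point: "u \<noteq> 0 \<Longrightarrow> Rep_xpoint (point u) = {k *\<^sub>R H u |k. True}"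
  by (auto simp: point_def Rep_hpt H_eq_0 span_singleton)

lemma point_in_line: "u \<noteq> 0 \<Longrightarrow> point u \<in> line m \<longleftrightarrow> m \<bullet> u = 0"
proof
  assume u: "u \<noteq> 0" "point u \<in> line m"
  then obtain v where v: "v \<noteq> 0" "m \<bullet> v = 0" "point u = point v" by (auto simp: line_def)
  then obtain k where "u = k *\<^sub>R v"
    using point_eq_iff[of v u] parallel_if_cross_eq_0[of v u] u by auto
  with v show "m \<bullet> u = 0" by simp
qed (auto simp: line_def)

text \<open>The coefficient vectors of a line in the two coordinate systems correspond under the adjoint
  of \<open>H\<close>, so both systems see the same lines.\<close>

lemma is_line_iff: "is_line l \<longleftrightarrow> (\<exists>m. m \<noteq> 0 \<and> l = line m)"
proof -
  define dual where "dual w = adjoint H w" for w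
  have dual: "w \<bullet> H u = dual w \<bullet> u" for w u
    unfolding dual_def using adjoint_works[OF linear_H, of u w] by (simp add: inner_commute)
  have eq: "{X. \<forall>v \<in> Rep_xpoint X. w \<bullet> v = 0} = line (dual w)" for w
  proof (intro set_eqI)
    fix X obtain u where u: "u \<noteq> 0" "X = point u" by (rule point_exhaust)
    have "(\<forall>v \<in> Rep_xpoint X. w \<bullet> v = 0) \<longleftrightarrow> dual w \<bullet> u = 0"
      unfolding u(2) Rep_point[OF u(1)] by (auto simp: dual intro: exI[of _ 1])
    then show "X \<in> {X. \<forall>v \<in> Rep_xpoint X. w \<bullet> v = 0} \<longleftrightarrow> X \<in> line (dual w)"
      using u point_in_line by simp
  qed
  have nz: "dual w \<noteq> 0" if "w \<noteq> 0" for w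
    using dual[of w "inv H w"] that by auto
  have onto: "\<exists>w. w \<noteq> 0 \<and> dual w = m" if "m \<noteq> 0" for m
  proof -
    define w where "w = adjoint (inv H) m"
    have w: "w \<bullet> H u = m \<bullet> u" for u
      unfolding w_def using adjoint_works[OF linear_inv_H, of "H u" m] by (simp add: inner_commute)
    then have "dual w \<bullet> u = m \<bullet> u" for u using dual by simp
    then have "dual w = m" using vector_eq_rdot by blast
    moreover have "w \<noteq> 0" using w[of m] that by auto
    ultimately show ?thesis by blast
  qed
  show ?thesis unfolding is_line_def eq using nz onto by metis
qed

lemma line_scale: "k \<noteq> 0 \<Longrightarrow> line (k *\<^sub>R m) = line m"
  by (simp add: line_def)

text \<open>The vector \<open>m \<times> (m \<times> n)\<close> lies on \<open>line m\<close>; if it also lies on \<open>line n\<close>, then \<open>m \<times> n\<close> has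
  norm zero.\<close>

lemma line_eq_imp:
  assumes "line m = line n"
  shows "m \<times> n = 0"
proof (rule ccontr)
  assume nz: "m \<times> n \<noteq> 0"
  define w where "w = m \<times> (m \<times> n)"
  have id: "n \<bullet> w = - ((m \<times> n) \<bullet> (m \<times> n))"
    unfolding w_def by (metis cross_skew cross_triple inner_commute inner_minus_left)
  then have w: "w \<noteq> 0" using nz by auto
  have "m \<bullet> w = 0" by (simp add: w_def dot_cross_self)
  then have "n \<bullet> w = 0" using assms w point_in_line by metis
  then show False using id nz by simp
qed

lemma join_point:
  assumes "u \<times> v \<noteq> 0"
  shows "join (point u) (point v) = line (u \<times> v)"
  unfolding join_def
proof (rule the_equality)
  have nz: "u \<noteq> 0" "v \<noteq> 0" using assms by auto
  show "is_line (line (u \<times> v)) \<and> point u \<in> line (u \<times> v) \<and> point v \<in> line (u \<times> v)"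
    using assms nz is_line_iff point_in_line by (auto simp: dot_cross_self)
  fix l assume l: "is_line l \<and> point u \<in> l \<and> point v \<in> l"
  then obtain m where m: "m \<noteq> 0" "l = line m" using is_line_iff by blast
  then have "m \<bullet> u = 0" "m \<bullet> v = 0" using l nz point_in_line by auto
  then have "m \<times> (u \<times> v) = 0"
    using Lagrange[of m u v] by simp
  then obtain k where k: "u \<times> v = k *\<^sub>R m" using parallel_if_cross_eq_0 m by blast
  then have "k \<noteq> 0" using assms by auto
  then show "l = line (u \<times> v)" using k m line_scale by simp
qed

text \<open>A version of \<open>join_point\<close> for a conveniently scaled coefficient vector.\<close>

lemma join_eqI:
  assumes "u \<times> v \<noteq> 0" "m \<noteq> 0" "m \<bullet> u = 0" "m \<bullet> v = 0"
  shows "join (point u) (point v) = line m"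
proof -
  have "m \<times> (u \<times> v) = 0" using Lagrange[of m u v] assms by simp
  then obtain k where k: "u \<times> v = k *\<^sub>R m" using parallel_if_cross_eq_0 assms by blast
  then have "k \<noteq> 0" using assms by auto
  then show ?thesis using k line_scale join_point assms by simp
qed

lemma lines_inter:
  assumes "m \<times> n \<noteq> 0" "u \<noteq> 0" "m \<bullet> u = 0" "n \<bullet> u = 0"
  shows "line m \<inter> line n = {point u}"
proof -
  have par: "point v = point u" if v: "v \<noteq> 0" "m \<bullet> v = 0" "n \<bullet> v = 0" for v
  proof -
    have "m \<times> n \<noteq> 0" "v \<times> (m \<times> n) = 0" "u \<times> (m \<times> n) = 0"
      using assms v Lagrange[of v m n] Lagrange[of u m n] by (simp_all add: inner_commute)
    then obtain k l where kl: "m \<times> n = k *\<^sub>R v" "m \<times> n = l *\<^sub>R u"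
      using parallel_if_cross_eq_0 v(1) assms(2) by metis
    then have "k \<noteq> 0" "l \<noteq> 0" using assms(1) by auto
    then show ?thesis using kl point_scale by metis
  qed
  show ?thesis
  proof (intro set_eqI)
    fix X obtain v where v: "v \<noteq> 0" "X = point v" by (rule point_exhaust)
    show "X \<in> line m \<inter> line n \<longleftrightarrow> X \<in> {point u}"
      using v par[OF v(1)] point_in_line[of v] point_in_line[of u] assms by auto
  qed
qed

lemma meet_eqI:
  assumes "m \<times> n \<noteq> 0" "u \<noteq> 0" "m \<bullet> u = 0" "n \<bullet> u = 0"
  shows "meet (line m) (line n) = point u"
  unfolding meet_def lines_inter[OF assms] by (rule the_equality) auto

end

section \<open>Midpoints and affine maps in barycentric coordinates\<close>

context triangle_frame
begin

definition combination :: "real^3 \<Rightarrow> real^2" where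
  "combination u = u $ 1 *\<^sub>R a + u $ 2 *\<^sub>R b + u $ 3 *\<^sub>R c"

lemma combination_linear [simp]:
  "combination (u + v) = combination u + combination v"
  "combination (u - v) = combination u - combination v"
  "combination (k *\<^sub>R u) = k *\<^sub>R combination u"
  by (simp_all add: combination_def algebra_simps)

lemma H_normalized: "wt u = 1 \<Longrightarrow> H u = hvec (combination u) 1"
  by (simp add: vec_eq_iff forall_3 H_def combination_def wt_def)

lemma point_normalized: "wt u = 1 \<Longrightarrow> point u = pt (combination u)"
  by (simp add: point_def pt_eq_hpt H_normalized)

lemma normalize:
  assumes "wt u \<noteq> 0"
  shows "wt ((1 / wt u) *\<^sub>R u) = 1" "point ((1 / wt u) *\<^sub>R u) = point u"
  using assms point_scale[of "1 / wt u"] by simp_all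

lemma point_eq_pt: "wt u \<noteq> 0 \<Longrightarrow> point u = pt ((1 / wt u) *\<^sub>R combination u)"
  using normalize[of u] point_normalized[of "(1 / wt u) *\<^sub>R u"] by simp

lemma coords_point: "wt u \<noteq> 0 \<Longrightarrow> coords (point u) = (1 / wt u) *\<^sub>R combination u"
  by (simp add: point_eq_pt)

lemma pt_exhaust: obtains u where "wt u = 1" "pt y = point u" "y = combination u"
proof -
  define u where "u = inv H (hvec y 1)"
  have "H u = hvec y 1" by (simp add: u_def)
  then have "wt u = 1" "pt y = point u" using H_3[of u] by (simp_all add: point_def pt_eq_hpt)
  moreover have "y = combination u" using calculation point_normalized by simp
  ultimately show ?thesis using that by blast
qed

lemma wt_nonzero: "wt u \<noteq> 0 \<Longrightarrow> u \<noteq> 0"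
  by (auto simp: wt_def)

lemma line_infty_eq: "line_infty = line (vector [1, 1, 1])"
proof (intro set_eqI)
  fix X obtain u where u: "u \<noteq> 0" "X = point u" by (rule point_exhaust)
  have "X \<in> line_infty \<longleftrightarrow> wt u = 0"
    unfolding line_infty_def u(2) mem_Collect_eq Rep_point[OF u(1)]
    using H_3[of u] by (auto intro: exI[of _ 1])
  then show "X \<in> line_infty \<longleftrightarrow> X \<in> line (vector [1, 1, 1])"
    using u by (simp add: point_in_line wt_def inner_vec_def sum_3)
qed

lemma ordinary_point: "u \<noteq> 0 \<Longrightarrow> ordinary (point u) \<longleftrightarrow> wt u \<noteq> 0"
  by (simp add: ordinary_def line_infty_eq point_in_line wt_def inner_vec_def sum_3)

lemma xmidpoint_point:
  assumes "wt u \<noteq> 0" "wt v \<noteq> 0"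
  shows "xmidpoint (point u) (point v) = point (wt v *\<^sub>R u + wt u *\<^sub>R v)"
proof -
  have w: "wt (wt v *\<^sub>R u + wt u *\<^sub>R v) = 2 * wt u * wt v" by simp
  have "midpoint (coords (point u)) (coords (point v))
      = (1 / (2 * wt u * wt v)) *\<^sub>R combination (wt v *\<^sub>R u + wt u *\<^sub>R v)"
    using assms by (simp add: coords_point midpoint_def scaleR_add_right)
  then show ?thesis
    using assms by (simp add: xmidpoint_def point_eq_pt[of "wt v *\<^sub>R u + wt u *\<^sub>R v"] w)
qed

lemma centroid_point:
  assumes "wt u \<noteq> 0" "wt v \<noteq> 0" "wt w \<noteq> 0"
  shows "centroid (point u) (point v) (point w) =
    point ((wt v * wt w) *\<^sub>R u + (wt u * wt w) *\<^sub>R v + (wt u * wt v) *\<^sub>R w)"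
proof -
  let ?s = "(wt v * wt w) *\<^sub>R u + (wt u * wt w) *\<^sub>R v + (wt u * wt v) *\<^sub>R w"
  have w: "wt ?s = 3 * wt u * wt v * wt w" by simp
  have "(1/3) *\<^sub>R (coords (point u) + coords (point v) + coords (point w))
      = (1 / (3 * wt u * wt v * wt w)) *\<^sub>R combination ?s"
    using assms by (simp add: coords_point scaleR_add_right)
  then show ?thesis using assms by (simp add: centroid_def point_eq_pt[of ?s] w)
qed

text \<open>The affine map of the plane that acts on barycentric vectors by \<open>N\<close>; for this \<open>N\<close> has to
  preserve weights.\<close>

definition transform :: "(real^3 \<Rightarrow> real^3) \<Rightarrow> real^2 \<Rightarrow> real^2" where
  "transform N = dehom (H \<circ> N \<circ> inv H)"

lemma
  assumes N: "linear N" "\<And>u. wt (N u) = wt u"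
  shows affine_transform: "affine_map (transform N)"
    and xmap_transform: "u \<noteq> 0 \<Longrightarrow> xmap (transform N) (point u) = point (N u)"
    and transform_combination: "wt u = 1 \<Longrightarrow> transform N (combination u) = combination (N u)"
proof -
  have L: "linear (H \<circ> N \<circ> inv H)"
    using linear_compose linear_H N(1) linear_inv_H by blast
  have L3: "(H \<circ> N \<circ> inv H) v $ 3 = v $ 3" for v
    using H_3[of "N (inv H v)"] H_3[of "inv H v"] N(2) by simp
  show aff: "affine_map (transform N)"
    unfolding transform_def by (rule affine_map_dehom[OF L L3])
  have h: "homogenize (transform N) = H \<circ> N \<circ> inv H"
    unfolding transform_def by (rule homogenize_dehom[OF L L3])
  show x: "xmap (transform N) (point u) = point (N u)" if "u \<noteq> 0" for u
    using xmap_hpt[of "transform N" "H u"] that L by (simp add: h H_eq_0 point_def)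
  show "transform N (combination u) = combination (N u)" if u: "wt u = 1"
  proof -
    have "pt (transform N (combination u)) = pt (combination (N u))"
      using x[of u] wt_nonzero[of u] xmap_pt[OF aff, of "combination u"] u N(2)[of u]
        point_normalized[of u] point_normalized[of "N u"] by simp
    then show ?thesis by simp
  qed
qed

lemma homothety_point:
  assumes "wt g \<noteq> 0" "u \<noteq> 0"
  shows "homothety (point g) k (point u) = point ((k * wt g) *\<^sub>R u + ((1 - k) * wt u) *\<^sub>R g)"
proof -
  define N where "N v = k *\<^sub>R v + ((1 - k) * wt v / wt g) *\<^sub>R g" for v
  have lin: "linear N"
    by (rule linearI) (simp_all add: N_def vec_eq_iff algebra_simps add_divide_distrib diff_divide_distrib)
  have w: "wt (N v) = wt v" for v using assms by (simp add: N_def field_simps)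
  have "(\<lambda>x. coords (point g) + k *\<^sub>R (x - coords (point g))) = transform N"
  proof
    fix x obtain v where v: "wt v = 1" "pt x = point v" "x = combination v" by (rule pt_exhaust)
    show "coords (point g) + k *\<^sub>R (x - coords (point g)) = transform N x"
    proof -
      have "combination (N v) = k *\<^sub>R combination v + ((1 - k) / wt g) *\<^sub>R combination g"
        using v(1) by (simp add: N_def)
      then show ?thesis
        using assms unfolding v(3) transform_combination[OF lin w v(1)]
        by (simp add: coords_point algebra_simps diff_divide_distrib)
    qed
  qed
  then have "homothety (point g) k (point u) = point (N u)"
    using xmap_transform[OF lin w assms(2)] by (simp add: homothety_def)
  also have "N u = (1 / wt g) *\<^sub>R ((k * wt g) *\<^sub>R u + ((1 - k) * wt u) *\<^sub>R g)"
    using assms by (simp add: N_def scaleR_add_right)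
  finally show ?thesis using assms point_scale by simp
qed

lemma affine_map_eqI:
  assumes f: "affine_map f" and g: "affine_map g" and eq: "f a = g a" "f b = g b" "f c = g c"
  shows "f = g"
proof
  have comb: "h (combination u) = u $ 1 *\<^sub>R h a + u $ 2 *\<^sub>R h b + u $ 3 *\<^sub>R h c"
    if "affine_map h" "wt u = 1" for h u
  proof -
    obtain L d where L: "linear L" "h = (\<lambda>x. L x + d)"
      using \<open>affine_map h\<close> by (auto simp: affine_map_def)
    have "d = (u $ 1 + u $ 2 + u $ 3) *\<^sub>R d" using that(2) by (simp add: wt_def)
    then have "d = u $ 1 *\<^sub>R d + u $ 2 *\<^sub>R d + u $ 3 *\<^sub>R d"
      by (simp only: scaleR_add_left)
    then show ?thesis
      by (simp add: L(2) combination_def linear_add[OF L(1)] linear_cmul[OF L(1)]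
          scaleR_add_right add_ac)
  qed
  fix x obtain u where u: "wt u = 1" "pt x = point u" "x = combination u" by (rule pt_exhaust)
  show "f x = g x" using comb[OF f u(1)] comb[OF g u(1)] eq u(3) by simp
qed

lemma vertex_points:
  "pt a = point (vector [1, 0, 0])" "pt b = point (vector [0, 1, 0])" "pt c = point (vector [0, 0, 1])"
  by (simp_all add: point_def pt_eq_hpt H_def)

lemma affine_taking_point:
  assumes w: "wt d = 1" "wt e = 1" "wt f = 1" and "u \<noteq> 0"
  shows "affine_taking (pt a) (pt b) (pt c) (point d) (point e) (point f) (point u) =
    point (u $ 1 *\<^sub>R d + u $ 2 *\<^sub>R e + u $ 3 *\<^sub>R f)"
proof -
  define N where "N u = u $ 1 *\<^sub>R d + u $ 2 *\<^sub>R e + u $ 3 *\<^sub>R f" for u :: "real^3"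
  have lin: "linear N" by (rule linearI) (simp_all add: N_def algebra_simps)
  have wN: "wt (N v) = wt v" for v using w by (simp add: N_def wt_def[of v])
  have N: "xmap (transform N) (pt a) = point d" "xmap (transform N) (pt b) = point e"
    "xmap (transform N) (pt c) = point f"
    by (simp_all add: vertex_points xmap_transform[OF lin wN] vec_eq_iff forall_3) (simp_all add: N_def)
  have "(THE h. affine_map h \<and> xmap h (pt a) = point d \<and> xmap h (pt b) = point e \<and>
      xmap h (pt c) = point f) = transform N"
  proof (rule the_equality)
    fix h assume h: "affine_map h \<and> xmap h (pt a) = point d \<and> xmap h (pt b) = point e \<and>
      xmap h (pt c) = point f"
    show "h = transform N"
      using h N affine_transform[OF lin wN] xmap_pt by (intro affine_map_eqI) (metis pt_eq_iff)+
  qed (use N affine_transform[OF lin wN] in blast)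
  then show ?thesis
    using xmap_transform[OF lin wN \<open>u \<noteq> 0\<close>] by (simp add: affine_taking_def) (simp add: N_def)
qed

text \<open>The reflection acts on normalized vectors by \<open>v \<mapsto> v - 2 (l \<bullet> v) / (l \<bullet> u) u\<close>. For uniqueness,
  let \<open>w\<close> be the image of \<open>v\<close>, both normalized. The difference \<open>w - v\<close> has weight zero
  and lies in the plane of \<open>v\<close> and \<open>u\<close>, hence is a multiple of \<open>u\<close>, and the midpoint condition
  fixes the multiple.\<close>

lemma affine_reflection_point:
  assumes u: "wt u = 0" "l \<bullet> u \<noteq> 0" and "v \<noteq> 0"
  shows "affine_reflection (point u) (line l) (point v) =
    point ((l \<bullet> u) *\<^sub>R v - (2 * (l \<bullet> v)) *\<^sub>R u)"
proof -
  define N where "N v = v - (2 * (l \<bullet> v) / (l \<bullet> u)) *\<^sub>R u" for v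
  have lin: "linear N" by (rule linearI) (simp_all add: N_def algebra_simps add_divide_distrib inner_add_right)
  have wN: "wt (N v) = wt v" for v using u by (simp add: N_def)
  have un: "u \<noteq> 0" using u by auto
  have mid: "pt (midpoint (combination v) (combination w)) \<in> line l \<longleftrightarrow> l \<bullet> (v + w) = 0"
    if "wt v = 1" "wt w = 1" for v w
  proof -
    have "pt (midpoint (combination v) (combination w)) = point (v + w)"
      using xmidpoint_point[of v w] that by (simp add: xmidpoint_def point_normalized)
    then show ?thesis using point_in_line[of "v + w" l] wt_nonzero[of "v + w"] that by simp
  qed
  have axis_iff: "pt (combination v) \<in> line l \<longleftrightarrow> l \<bullet> v = 0" if "wt v = 1" for v
    using that point_normalized[of v] point_in_line[of v] wt_nonzero[of v] by simp
  let ?refl = "\<lambda>f. affine_map f \<and> (\<forall>y. pt y \<in> line l \<longrightarrow> f y = y) \<and>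
       (\<forall>y. pt y \<notin> line l \<longrightarrow>
          point u \<in> join (pt y) (pt (f y)) \<and> pt (midpoint y (f y)) \<in> line l)"
  have image: "f y = transform N y" if f: "?refl f" for f y
  proof -
    obtain v where v: "wt v = 1" "pt y = point v" "y = combination v" by (rule pt_exhaust)
    obtain w where w: "wt w = 1" "pt (f y) = point w" "f y = combination w" by (rule pt_exhaust)
    have "combination w = combination (N v)"
    proof (cases "l \<bullet> v = 0")
      case True
      then show ?thesis using f w v axis_iff[of v] by (simp add: N_def)
    next
      case False
      then have "pt y \<notin> line l" using v axis_iff[of v] by simp
      then have "point u \<in> join (pt y) (pt (f y))" "pt (midpoint y (f y)) \<in> line l"
        using f by blast+
      then have "point u \<in> join (point v) (point w)" "l \<bullet> (v + w) = 0"
        using v(1,3) w(1,3) mid[of v w] unfolding v(2) w(2) by simp_all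
      define \<delta> where "\<delta> = w - v"
      \<comment> \<open>The join of a point with itself is unspecified, so the two points must first be shown
        to differ: otherwise their midpoint would be off the axis.\<close>
      have "\<delta> \<noteq> 0" using False \<open>l \<bullet> (v + w) = 0\<close> by (auto simp: \<delta>_def inner_add_right)
      have "wt \<delta> = 0" using v w by (simp add: \<delta>_def)
      have vw: "v \<times> w = v \<times> \<delta>" by (simp add: \<delta>_def Cross3.right_diff_distrib)
      have "v \<times> w \<noteq> 0"
      proof
        assume "v \<times> w = 0"
        then obtain k where "w = k *\<^sub>R v" using parallel_if_cross_eq_0 wt_nonzero[of v] v by auto
        then show False using v w \<open>\<delta> \<noteq> 0\<close> by (simp add: \<delta>_def)
      qed
      then have "(v \<times> \<delta>) \<bullet> u = 0"
        using \<open>point u \<in> join (point v) (point w)\<close> join_point point_in_line[OF un] vw by simp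
      \<comment> \<open>Two vectors of weight zero have a cross product proportional to \<open>(1, 1, 1)\<close>; pairing
        with \<open>v\<close>, which has weight one, gives the factor.\<close>
      moreover have "\<delta> \<times> u = ((v \<times> \<delta>) \<bullet> u) *\<^sub>R vector [1, 1, 1]"
      proof -
        have e: "v $ 1 = 1 - v $ 2 - v $ 3" "\<delta> $ 1 = - \<delta> $ 2 - \<delta> $ 3" "u $ 1 = - u $ 2 - u $ 3"
          using v(1) \<open>wt \<delta> = 0\<close> u(1) by (simp_all add: wt_def)
        show ?thesis by (simp add: cross3_simps forall_3 e)
      qed
      ultimately have "u \<times> \<delta> = 0" by (metis cross_skew neg_equal_0_iff_equal scale_zero_left)
      then obtain t where t: "\<delta> = t *\<^sub>R u" using parallel_if_cross_eq_0 un by blast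
      then have wv: "w = v + t *\<^sub>R u" by (simp add: \<delta>_def algebra_simps)
      then have "2 * (l \<bullet> v) + t * (l \<bullet> u) = 0"
        using \<open>l \<bullet> (v + w) = 0\<close> unfolding wv inner_add_right inner_scaleR_right by linarith
      then have "t = - (2 * (l \<bullet> v) / (l \<bullet> u))" using u by (simp add: field_simps)
      then show ?thesis using wv by (simp add: N_def)
    qed
    then show ?thesis using transform_combination[OF lin wN v(1)] v w by auto
  qed
  have refl: "?refl (transform N)"
  proof (intro conjI allI impI)
    show "affine_map (transform N)" by (rule affine_transform[OF lin wN])
    fix y
    obtain v where v: "wt v = 1" "pt y = point v" "y = combination v" by (rule pt_exhaust)
    have Ny: "transform N y = combination (N v)" using transform_combination[OF lin wN v(1)] v by simp
    show "transform N y = y" if "pt y \<in> line l"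
      using that axis_iff[of v] v Ny by (simp add: N_def)
    assume "pt y \<notin> line l"
    then have lv: "l \<bullet> v \<noteq> 0" using axis_iff[of v] v by simp
    have Nv: "l \<bullet> (v + N v) = 0"
      using u unfolding N_def inner_add_right inner_diff_right inner_scaleR_right by simp
    then show "pt (midpoint y (transform N y)) \<in> line l"
      using mid[of v "N v"] v wN[of v] Ny by simp
    have cr: "v \<times> N v = (- (2 * (l \<bullet> v) / (l \<bullet> u))) *\<^sub>R (v \<times> u)"
      by (simp add: N_def Cross3.right_diff_distrib cross_mult_right)
    have "v \<times> u \<noteq> 0"
    proof
      assume "v \<times> u = 0"
      then obtain k where k: "u = k *\<^sub>R v" using parallel_if_cross_eq_0 wt_nonzero[of v] v by auto
      then show False using un u v by simp
    qed
    then have "v \<times> N v \<noteq> 0" using cr lv u by simp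
    moreover have "(v \<times> N v) \<bullet> u = 0" unfolding cr by (simp add: dot_cross_self del: inner_eq_zero_iff)
    moreover have "pt (transform N y) = point (N v)"
      using Ny point_normalized[of "N v"] wN[of v] v by simp
    ultimately show "point u \<in> join (pt y) (pt (transform N y))"
      using join_point v point_in_line[OF un] by simp
  qed
  have "(THE f. ?refl f) = transform N"
    by (rule the_equality[of ?refl, OF refl]) (rule ext, rule image)
  then have "affine_reflection (point u) (line l) (point v) = point (N v)"
    using xmap_transform[OF lin wN \<open>v \<noteq> 0\<close>] by (simp add: affine_reflection_def)
  also have "N v = (1 / (l \<bullet> u)) *\<^sub>R ((l \<bullet> u) *\<^sub>R v - (2 * (l \<bullet> v)) *\<^sub>R u)"
    using u by (simp add: N_def scaleR_diff_right)
  finally show ?thesis using u point_scale by simp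
qed

text \<open>Since the images of the two spanning vectors stay independent, \<open>N\<close> is injective on the plane that
  they span. So no point of the line is sent to the zero vector, which represents no point.\<close>

lemma image_join:
  assumes T: "\<And>w. w \<noteq> 0 \<Longrightarrow> T (point w) = point (N w)" and N: "linear N"
    and uv: "u \<times> v \<noteq> 0" and Nuv: "N u \<times> N v \<noteq> 0"
  shows "T ` join (point u) (point v) = join (point (N u)) (point (N v))"
proof (intro subset_antisym subsetI)
  have comb: "N (\<alpha> *\<^sub>R u + \<beta> *\<^sub>R v) = \<alpha> *\<^sub>R N u + \<beta> *\<^sub>R N v" for \<alpha> \<beta>
    by (simp add: linear_add[OF N] linear_cmul[OF N])
  fix Y assume "Y \<in> T ` join (point u) (point v)"
  then obtain w where w: "w \<noteq> 0" "(u \<times> v) \<bullet> w = 0" "Y = point (N w)"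
    using T by (auto simp: join_point[OF uv] line_def)
  then obtain \<alpha> \<beta> where ab: "w = \<alpha> *\<^sub>R u + \<beta> *\<^sub>R v" using in_span_cross[OF uv] by blast
  have "N w \<noteq> 0"
  proof
    assume 0: "N w = 0"
    then have "N u \<times> (\<alpha> *\<^sub>R N u + \<beta> *\<^sub>R N v) = 0" "(\<alpha> *\<^sub>R N u + \<beta> *\<^sub>R N v) \<times> N v = 0"
      by (simp_all add: ab comb)
    then have "\<alpha> = 0" "\<beta> = 0"
      using Nuv by (simp_all add: cross_add_left cross_add_right cross_mult_left cross_mult_right)
    then show False using w ab by simp
  qed
  moreover have "(N u \<times> N v) \<bullet> N w = 0"
    by (simp add: ab comb inner_add_right dot_cross_self)
  ultimately show "Y \<in> join (point (N u)) (point (N v))"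
    using w by (auto simp: join_point[OF Nuv] line_def)
next
  have comb: "N (\<alpha> *\<^sub>R u + \<beta> *\<^sub>R v) = \<alpha> *\<^sub>R N u + \<beta> *\<^sub>R N v" for \<alpha> \<beta>
    by (simp add: linear_add[OF N] linear_cmul[OF N])
  fix Y assume "Y \<in> join (point (N u)) (point (N v))"
  then obtain z where z: "z \<noteq> 0" "(N u \<times> N v) \<bullet> z = 0" "Y = point z"
    by (auto simp: join_point[OF Nuv] line_def)
  then obtain \<alpha> \<beta> where "z = \<alpha> *\<^sub>R N u + \<beta> *\<^sub>R N v" using in_span_cross[OF Nuv] by blast
  then have Nz: "N (\<alpha> *\<^sub>R u + \<beta> *\<^sub>R v) = z" using comb by simp
  then have nz: "\<alpha> *\<^sub>R u + \<beta> *\<^sub>R v \<noteq> 0" using z(1) linear_0[OF N] by metis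
  have "(u \<times> v) \<bullet> (\<alpha> *\<^sub>R u + \<beta> *\<^sub>R v) = 0" by (simp add: inner_add_right dot_cross_self)
  then have "point (\<alpha> *\<^sub>R u + \<beta> *\<^sub>R v) \<in> join (point u) (point v)"
    using nz by (auto simp: join_point[OF uv] line_def)
  moreover have "T (point (\<alpha> *\<^sub>R u + \<beta> *\<^sub>R v)) = Y" using T[OF nz] Nz z by simp
  ultimately show "Y \<in> T ` join (point u) (point v)" by blast
qed

end

section \<open>Conics in barycentric coordinates\<close>

lemma form_pullback:
  fixes f :: "real^3 \<Rightarrow> real^3"
  assumes M: "nondegenerate_form M" and f: "linear f" "inj f"
  obtains S where "nondegenerate_form S" "\<And>u v. f u \<bullet> (M *v f v) = u \<bullet> (S *v v)"
proof
  let ?F = "matrix f"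
  let ?S = "transpose ?F ** M ** ?F"
  have F: "?F *v u = f u" for u using f(1) by (simp add: matrix_vector_mul)
  have "det ?F \<noteq> 0" using f by (simp add: det_nz_iff_inj)
  then show "nondegenerate_form ?S"
    using M by (simp add: nondegenerate_form_def det_mul det_transpose matrix_transpose_mul
        matrix_mul_assoc)
  fix u v
  have "u \<bullet> (?S *v v) = u \<bullet> (transpose ?F *v (M *v f v))"
    by (simp add: F flip: matrix_vector_mul_assoc)
  also have "\<dots> = (?F *v u) \<bullet> (M *v f v)"
    by (metis dot_lmul_matrix inner_commute transpose_matrix_vector)
  finally show "f u \<bullet> (M *v f v) = u \<bullet> (?S *v v)" by (simp add: F)
qed

lemma symmetric_form_commute:
  fixes S :: "real^3^3"
  assumes "transpose S = S"
  shows "u \<bullet> (S *v v) = (S *v u) \<bullet> v"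
  by (metis assms dot_lmul_matrix transpose_matrix_vector)

lemma nondegenerate_form_eq_0:
  assumes "nondegenerate_form S" "S *v u = 0"
  shows "u = 0"
  using assms det_nz_iff_inj[of "(*v) S"] linear_injective_0[of "(*v) S"]
  by (simp add: nondegenerate_form_def)

lemma nondegenerate_form_scale:
  assumes "nondegenerate_form (k *\<^sub>R S)"
  shows "k \<noteq> 0"
  using assms by (auto simp: nondegenerate_form_def det_3)

context triangle_frame
begin

definition conic :: "real^3^3 \<Rightarrow> xpoint set" where
  "conic S = {point u |u. u \<noteq> 0 \<and> u \<bullet> (S *v u) = 0}"

text \<open>\<open>S\<close> is the Gram matrix of the form \<open>M\<close> in barycentric coordinates.\<close>

definition represents :: "real^3^3 \<Rightarrow> real^3^3 \<Rightarrow> bool" where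
  "represents M S \<longleftrightarrow> (\<forall>u v. H u \<bullet> (M *v H v) = u \<bullet> (S *v v))"

lemma form_in_frame:
  assumes "nondegenerate_form M"
  obtains S where "nondegenerate_form S" "represents M S"
  using form_pullback[OF assms linear_H inj_H] unfolding represents_def by metis

lemma form_from_frame:
  assumes "nondegenerate_form S"
  obtains M where "nondegenerate_form M" "represents M S"
proof -
  have "inj (inv H)" using inv_H by (metis injI)
  with form_pullback[OF assms linear_inv_H] obtain M
    where "nondegenerate_form M" "\<And>u v. inv H u \<bullet> (S *v inv H v) = u \<bullet> (M *v v)" by metis
  then show ?thesis using that unfolding represents_def by (metis inv_H(1))
qed

lemma form_scale:
  fixes S :: "real^3^3"
  shows "(k *\<^sub>R u) \<bullet> (S *v (l *\<^sub>R v)) = k * (l * (u \<bullet> (S *v v)))"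
  by (simp add: matrix_vector_mult_scaleR)

lemma ball_Rep_point:
  "u \<noteq> 0 \<Longrightarrow> (\<forall>v \<in> Rep_xpoint (point u). \<phi> v) \<longleftrightarrow> (\<forall>k. \<phi> (k *\<^sub>R H u))"
  by (auto simp: Rep_point)

lemma point_in_conic: "u \<noteq> 0 \<Longrightarrow> point u \<in> conic S \<longleftrightarrow> u \<bullet> (S *v u) = 0"
proof
  assume u: "u \<noteq> 0" "point u \<in> conic S"
  then obtain v where v: "v \<noteq> 0" "v \<bullet> (S *v v) = 0" "point u = point v"
    by (auto simp: conic_def)
  then obtain k where "u = k *\<^sub>R v"
    using point_eq_iff[of v u] parallel_if_cross_eq_0[of v u] u by auto
  then show "u \<bullet> (S *v u) = 0" using form_scale[of k v S k v] v by simp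
qed (auto simp: conic_def)

lemma conic_of_represents:
  assumes "represents M S"
  shows "conic_of M = conic S"
proof (intro set_eqI)
  fix X obtain u where u: "u \<noteq> 0" "X = point u" by (rule point_exhaust)
  have "X \<in> conic_of M \<longleftrightarrow> (\<forall>k. k * (k * (u \<bullet> (S *v u))) = 0)"
    using assms unfolding represents_def
    by (simp only: conic_of_def u(2) mem_Collect_eq ball_Rep_point[OF u(1)] form_scale)
  also have "\<dots> \<longleftrightarrow> u \<bullet> (S *v u) = 0" by (auto dest: spec[of _ 1])
  finally show "X \<in> conic_of M \<longleftrightarrow> X \<in> conic S" using u point_in_conic by simp
qed

lemma polar_represents:
  assumes "represents M S" "transpose S = S" "u \<noteq> 0"
  shows "polar M (point u) = line (S *v u)"
proof (intro set_eqI)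
  fix X obtain v where v: "v \<noteq> 0" "X = point v" by (rule point_exhaust)
  have "X \<in> polar M (point u) \<longleftrightarrow> (\<forall>k l. k * (l * (u \<bullet> (S *v v))) = 0)"
    using assms(1) unfolding represents_def
    by (simp only: polar_def v(2) mem_Collect_eq ball_Rep_point[OF v(1)] ball_Rep_point[OF assms(3)]
        form_scale)
  also have "\<dots> \<longleftrightarrow> u \<bullet> (S *v v) = 0" by (auto dest: spec[of _ 1])
  finally show "X \<in> polar M (point u) \<longleftrightarrow> X \<in> line (S *v u)"
    using v by (simp add: point_in_line symmetric_form_commute[OF assms(2)])
qed

lemma conic_scale: "k \<noteq> 0 \<Longrightarrow> conic (k *\<^sub>R S) = conic S"
  by (simp add: conic_def flip: scaleR_matrix_vector_assoc)

text \<open>A conic as a point set does not come with a form, so both descriptions need that the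
  form is determined up to a factor. This is the hypothesis \<open>unique\<close>, to be verified for the points
  at hand. The center is then found by solving \<open>S z = k (1, 1, 1)\<close>, since \<open>(1, 1, 1)\<close> is the
  coefficient vector of the line at infinity.\<close>

lemma conic_through_and_center:
  assumes S: "nondegenerate_form S" and pts: "\<And>v. v \<in> Pts \<Longrightarrow> v \<noteq> 0 \<and> v \<bullet> (S *v v) = 0"
    and unique: "\<And>N. nondegenerate_form N \<Longrightarrow> (\<And>v. v \<in> Pts \<Longrightarrow> v \<bullet> (N *v v) = 0) \<Longrightarrow> \<exists>k. N = k *\<^sub>R S"
    and Pts: "Pts \<noteq> {}"
  shows "(THE C. nondegenerate_conic C \<and> point ` Pts \<subseteq> C) = conic S"
    and "S *v z = k *\<^sub>R vector [1, 1, 1] \<Longrightarrow> k \<noteq> 0 \<Longrightarrow> conic_center (conic S) = point z"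
proof -
  have same: "\<exists>k. k \<noteq> 0 \<and> N = k *\<^sub>R S"
    if N: "nondegenerate_form N" "point ` Pts \<subseteq> conic N" for N
  proof -
    have "\<exists>k. N = k *\<^sub>R S"
      using unique[OF N(1)] N pts point_in_conic by blast
    then show ?thesis using N(1) nondegenerate_form_scale by blast
  qed
  have sub: "point ` Pts \<subseteq> conic S" using pts by (auto simp: conic_def)
  obtain M where M: "nondegenerate_form M" "represents M S" using form_from_frame S .
  show "(THE C. nondegenerate_conic C \<and> point ` Pts \<subseteq> C) = conic S"
  proof (rule the_equality)
    show "nondegenerate_conic (conic S) \<and> point ` Pts \<subseteq> conic S"
      using sub Pts M conic_of_represents[of M S] unfolding nondegenerate_conic_def by blast
    fix C assume C: "nondegenerate_conic C \<and> point ` Pts \<subseteq> C"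
    then obtain M' where M': "nondegenerate_form M'" "C = conic_of M'"
      unfolding nondegenerate_conic_def by blast
    obtain N where N: "nondegenerate_form N" "represents M' N" using form_in_frame M'(1) .
    have "C = conic N" using M' N conic_of_represents by simp
    then show "C = conic S" using same[OF N(1)] C conic_scale by auto
  qed
  assume z: "S *v z = k *\<^sub>R vector [1, 1, 1]" "k \<noteq> 0"
  have "(vector [1, 1, 1] :: real^3) \<noteq> 0" by (simp add: vec_eq_iff forall_3)
  with z have z0: "z \<noteq> 0" by auto
  show "conic_center (conic S) = point z"
    unfolding conic_center_def pole_def
  proof (rule the_equality)
    have "polar M (point z) = line_infty"
      using polar_represents[OF M(2) _ z0] S z line_scale[of k "vector [1,1,1]"]
      by (simp add: nondegenerate_form_def line_infty_eq)
    then show "\<exists>M. nondegenerate_form M \<and> conic S = conic_of M \<and> polar M (point z) = line_infty"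
      using M conic_of_represents by blast
    fix X assume "\<exists>M. nondegenerate_form M \<and> conic S = conic_of M \<and> polar M X = line_infty"
    then obtain M' where M': "nondegenerate_form M'" "conic S = conic_of M'" "polar M' X = line_infty"
      by blast
    obtain N where N: "nondegenerate_form N" "represents M' N" using form_in_frame M'(1) .
    then obtain l where l: "l \<noteq> 0" "N = l *\<^sub>R S"
      using same[OF N(1)] sub M'(2) conic_of_represents by auto
    obtain u where u: "u \<noteq> 0" "X = point u" by (rule point_exhaust)
    have "line (N *v u) = line (vector [1, 1, 1])"
      using polar_represents[OF N(2) _ u(1)] N(1) M'(3) u(2)
      by (simp add: nondegenerate_form_def line_infty_eq)
    then have "(vector [1, 1, 1]) \<times> (N *v u) = 0"
      using line_eq_imp by metis
    then obtain t where "N *v u = t *\<^sub>R vector [1, 1, 1]"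
      using parallel_if_cross_eq_0 \<open>vector [1,1,1] \<noteq> 0\<close> by blast
    then have "l *\<^sub>R (S *v u) = (t / k) *\<^sub>R (S *v z)"
      using l z by (simp add: scaleR_matrix_vector_assoc)
    then have "S *v (l *\<^sub>R u - (t / k) *\<^sub>R z) = 0"
      by (simp add: matrix_vector_mult_scaleR matrix_vector_mult_diff_distrib)
    then have "l *\<^sub>R u = (t / k) *\<^sub>R z" using nondegenerate_form_eq_0[OF S] by fastforce
    moreover from this have "t / k \<noteq> 0" using l u by auto
    ultimately show "X = point z" using point_scale l u by metis
  qed
qed

end

section \<open>Polynomial identities\<close>

text \<open>Rotating \<open>A, B, C\<close> rotates the coordinates of a point whose construction treats the vertices alike,
  so its first coordinate, as a function of \<open>x, y, z\<close>, determines the others.\<close>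

definition cyclic :: "(real \<Rightarrow> real \<Rightarrow> real \<Rightarrow> real) \<Rightarrow> real \<Rightarrow> real \<Rightarrow> real \<Rightarrow> real^3" where
  "cyclic \<phi> x y z = vector [\<phi> x y z, \<phi> y z x, \<phi> z x y]"

definition isotomic_vec :: "real \<Rightarrow> real \<Rightarrow> real \<Rightarrow> real^3" where
  "isotomic_vec = cyclic (\<lambda>x y z. y * z)"

definition Q_vec :: "real \<Rightarrow> real \<Rightarrow> real \<Rightarrow> real^3" where
  "Q_vec = cyclic (\<lambda>x y z. x * (y + z))"

definition V_vec :: "real \<Rightarrow> real \<Rightarrow> real \<Rightarrow> real^3" where
  "V_vec = cyclic (\<lambda>x y z. x * (y\<^sup>2 + y * z + z\<^sup>2))"

text \<open>Coefficients of the line \<open>GV\<close>.\<close>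

definition axis_vec :: "real \<Rightarrow> real \<Rightarrow> real \<Rightarrow> real^3" where
  "axis_vec = cyclic (\<lambda>x y z. (y - z) * (x\<^sup>2 - y * z))"

text \<open>The infinite point \<open>V\<^sub>\<infinity>\<close>.\<close>

definition direction_vec :: "real \<Rightarrow> real \<Rightarrow> real \<Rightarrow> real^3" where
  "direction_vec = cyclic (\<lambda>x y z. (y + z) * (y * z - x\<^sup>2))"

definition G1_vec :: "real \<Rightarrow> real \<Rightarrow> real \<Rightarrow> real^3" where
  "G1_vec = cyclic (\<lambda>x y z. x * (y + z) * (2 * x + y + z))"

definition J_vec :: "real \<Rightarrow> real \<Rightarrow> real \<Rightarrow> real^3" where
  "J_vec = cyclic (\<lambda>x y z. x * (2 * (x * y + y * z + z * x) + (x + y + z) * (y + z)))"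

definition Z_vec :: "real \<Rightarrow> real \<Rightarrow> real \<Rightarrow> real^3" where
  "Z_vec = cyclic (\<lambda>x y z. x * (y - z)\<^sup>2)"

text \<open>The map \<open>T\<^sub>P\<close>, cleared of denominators by the factor \<open>(y + z)(z + x)(x + y)\<close>. A common factor
  does not change the action on points.\<close>

definition cevian_map :: "real \<Rightarrow> real \<Rightarrow> real \<Rightarrow> real^3 \<Rightarrow> real^3" where
  "cevian_map x y z w = vector
    [x * (y + z) * (w $ 2 * (x + y) + w $ 3 * (z + x)),
     y * (z + x) * (w $ 3 * (y + z) + w $ 1 * (x + y)),
     z * (x + y) * (w $ 1 * (z + x) + w $ 2 * (y + z))]"

lemmas vec_defs = isotomic_vec_def Q_vec_def V_vec_def axis_vec_def direction_vec_def G1_vec_def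
  J_vec_def Z_vec_def cyclic_def

lemmas coordinate_simps = vec_defs vec_eq_iff forall_3 inner_vec_def sum_3 power2_eq_square algebra_simps

text \<open>The expected center is on the line \<open>G\<^sub>1J\<close>.\<close>

lemma Z_eq_G1_J: "Z_vec x y z = 3 *\<^sub>R G1_vec x y z - 2 *\<^sub>R J_vec x y z"
  by (simp add: coordinate_simps)

text \<open>The expected center is on the line \<open>GV\<close>.\<close>

lemma Z_eq_V_G: "Z_vec x y z = V_vec x y z - (3 * x * y * z) *\<^sub>R vector [1, 1, 1]"
  by (simp add: coordinate_simps)

text \<open>Together with \<open>cevian_map_G\<close> this is the reason why \<open>T\<^sub>P\<close> sends \<open>GV\<close> to \<open>G\<^sub>1J\<close>.\<close>

lemma cevian_map_V:
  "cevian_map x y z (V_vec x y z) =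
    ((y + z) * (z + x) * (x + y)) *\<^sub>R J_vec x y z
    - ((x + y + z) * (x * y + y * z + z * x)) *\<^sub>R G1_vec x y z"
  by (simp add: cevian_map_def coordinate_simps)

lemma cevian_map_G: "cevian_map x y z (vector [1, 1, 1]) = G1_vec x y z"
  by (simp add: cevian_map_def coordinate_simps)

lemma axis_cross: "(vector [1, 1, 1]) \<times> V_vec x y z = - axis_vec x y z"
  by (simp add: cross3_def coordinate_simps)

text \<open>Each factor vanishes only in an excluded position of \<open>P\<close>, so \<open>G\<^sub>1\<close> is never on \<open>GV\<close>. The value is
  opposite to the one for \<open>V\<^sub>\<infinity>\<close> in the next lemma, which puts the midpoint of \<open>G\<^sub>1\<close> and its translate by twice
  the direction vector on \<open>GV\<close>.\<close>

lemma axis_G1: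
  "axis_vec x y z \<bullet> G1_vec x y z =
    - (2 * ((x - y) * (y - z) * (z - x)) * (x + y + z) * (x * y + y * z + z * x))"
  by (simp add: coordinate_simps)

lemma axis_direction:
  "axis_vec x y z \<bullet> direction_vec x y z =
    2 * ((x - y) * (y - z) * (z - x)) * (x + y + z) * (x * y + y * z + z * x)"
  by (simp add: coordinate_simps)

lemma axis_Z: "axis_vec x y z \<bullet> Z_vec x y z = 0"
  by (simp add: coordinate_simps)

text \<open>The effect of exchanging \<open>P\<close> with its isotomic conjugate. The last line is the reason why \<open>\<eta>\<close>
  exchanges \<open>G\<^sub>1\<close> and \<open>G\<^sub>2\<close>: they differ by a vector in the direction of \<open>V\<^sub>\<infinity>\<close>.\<close>

lemma isotomic_scale:
  "isotomic_vec (y * z) (z * x) (x * y) = (x * y * z) *\<^sub>R vector [x, y, z]"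
  "Q_vec (y * z) (z * x) (x * y) = (x * y * z) *\<^sub>R cyclic (\<lambda>x y z. y + z) x y z"
  "V_vec (y * z) (z * x) (x * y) = (x * y * z) *\<^sub>R V_vec x y z"
  "Z_vec (y * z) (z * x) (x * y) = (x * y * z) *\<^sub>R Z_vec x y z"
  "axis_vec (y * z) (z * x) (x * y) = (x * y * z) *\<^sub>R axis_vec x y z"
  "G1_vec (y * z) (z * x) (x * y) = (x * y * z) *\<^sub>R (G1_vec x y z + 2 *\<^sub>R direction_vec x y z)"
  by (simp_all add: coordinate_simps)

section \<open>The configuration of a point and its isotomic conjugate\<close>

lemma cyclic_nonzero: "\<phi> x y z \<noteq> 0 \<Longrightarrow> cyclic \<phi> x y z \<noteq> 0"
  by (auto simp: cyclic_def vec_eq_iff forall_3)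

context triangle_frame
begin

lemma join_vertices:
  "join (pt b) (pt c) = line (vector [1, 0, 0])"
  "join (pt c) (pt a) = line (vector [0, 1, 0])"
  "join (pt a) (pt b) = line (vector [0, 0, 1])"
  unfolding vertex_points by (rule join_eqI; simp add: cross3_def coordinate_simps)+

lemma centroid_triangle: "centroid (pt a) (pt b) (pt c) = point (vector [1, 1, 1])"
proof -
  have "(vector [1, 0, 0] :: real^3) + vector [0, 1, 0] + vector [0, 0, 1] = vector [1, 1, 1]"
    by (simp add: vec_eq_iff forall_3)
  then show ?thesis by (simp add: vertex_points centroid_point)
qed

definition complement :: "xpoint \<Rightarrow> xpoint" where
  "complement = homothety (point (vector [1, 1, 1])) (- 1 / 2)"

definition complement_vec :: "real^3 \<Rightarrow> real^3" where
  "complement_vec u = cyclic (\<lambda>x y z. y + z) (u $ 1) (u $ 2) (u $ 3)"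

lemma complement_point: "u \<noteq> 0 \<Longrightarrow> complement (point u) = point (complement_vec u)"
proof -
  assume u: "u \<noteq> 0"
  have "(- 1 / 2 * wt (vector [1, 1, 1])) *\<^sub>R u + ((1 - - 1 / 2) * wt u) *\<^sub>R vector [1, 1, 1]
    = (3 / 2) *\<^sub>R complement_vec u"
    by (simp add: vec_eq_iff forall_3 complement_vec_def cyclic_def) (simp add: wt_def)
  moreover have "wt (vector [1, 1, 1]) \<noteq> 0" by simp
  ultimately show ?thesis
    unfolding complement_def using homothety_point[of "vector [1, 1, 1]" u "- 1 / 2"] u point_scale
    by (simp only:) simp
qed

lemma complement_vec_eq_0: "complement_vec u = 0 \<Longrightarrow> u = 0"
  by (simp add: complement_vec_def cyclic_def vec_eq_iff forall_3)

text \<open>The anticomplementary triangle is given through the inverse of the extended homothety, so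
  injectivity is needed at the infinite points too.\<close>

lemma inj_complement: "inj complement"
proof (rule injI)
  fix X Y assume eq: "complement X = complement Y"
  obtain u where u: "u \<noteq> 0" "X = point u" by (rule point_exhaust)
  obtain v where v: "v \<noteq> 0" "Y = point v" by (rule point_exhaust)
  have "complement_vec u \<noteq> 0" "complement_vec v \<noteq> 0" using complement_vec_eq_0 u v by blast+
  moreover have "point (complement_vec u) = point (complement_vec v)"
    using eq u v complement_point by simp
  ultimately obtain k where "complement_vec v = k *\<^sub>R complement_vec u"
    using point_eq_iff parallel_if_cross_eq_0 by blast
  then have "complement_vec (v - k *\<^sub>R u) = 0"
    by (simp add: complement_vec_def cyclic_def vec_eq_iff forall_3 algebra_simps)
  then have "v = k *\<^sub>R u" using complement_vec_eq_0 by fastforce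
  then show "X = Y" using u v point_scale by (metis scale_zero_left)
qed

lemma inv_complement:
  "inv complement (pt a) = point (vector [- 1, 1, 1])"
  "inv complement (pt b) = point (vector [1, - 1, 1])"
  "inv complement (pt c) = point (vector [1, 1, - 1])"
proof -
  have inv: "inv complement (point v) = point u" if "u \<noteq> 0" "complement_vec u = 2 *\<^sub>R v" for u v
    using that complement_point[of u] point_scale[of 2 v]
    by (intro inv_f_eq[OF inj_complement]) simp
  show "inv complement (pt a) = point (vector [- 1, 1, 1])"
    "inv complement (pt b) = point (vector [1, - 1, 1])"
    "inv complement (pt c) = point (vector [1, 1, - 1])"
    unfolding vertex_points
    by (intro inv; simp add: complement_vec_def cyclic_def vec_eq_iff forall_3)+
qed

end

text \<open>The position hypotheses on \<open>P = (x : y : z)\<close> in coordinates. That \<open>P\<close> and \<open>P'\<close> are ordinary is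
  added in a second step, because the coordinates of \<open>P'\<close> have to be known first.\<close>

locale cevian_configuration = triangle_frame +
  fixes x y z :: real
  assumes off_sides: "x \<noteq> 0" "y \<noteq> 0" "z \<noteq> 0"
    and off_anticomplementary_sides: "y + z \<noteq> 0" "z + x \<noteq> 0" "x + y \<noteq> 0"
    and off_medians: "y \<noteq> z" "z \<noteq> x" "x \<noteq> y"
begin

lemmas nz = off_sides off_anticomplementary_sides off_medians off_medians[symmetric]

abbreviation "P \<equiv> point (vector [x, y, z])"
abbreviation "P' \<equiv> point (isotomic_vec x y z)"
abbreviation "Q \<equiv> point (Q_vec x y z)"
abbreviation "Q' \<equiv> point (cyclic (\<lambda>x y z. y + z) x y z)"
abbreviation "G \<equiv> point (vector [1, 1, 1])"
abbreviation "V \<equiv> point (V_vec x y z)"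
abbreviation "D \<equiv> point (vector [0, y, z])"
abbreviation "E \<equiv> point (vector [x, 0, z])"
abbreviation "F \<equiv> point (vector [x, y, 0])"
abbreviation "D3 \<equiv> point (vector [0, z, y])"
abbreviation "E3 \<equiv> point (vector [z, 0, x])"
abbreviation "F3 \<equiv> point (vector [y, x, 0])"
abbreviation "G1 \<equiv> point (G1_vec x y z)"
abbreviation "J \<equiv> point (J_vec x y z)"
abbreviation "Z \<equiv> point (Z_vec x y z)"

lemma cevian_trace_points:
  "cevian_trace (pt a) P (pt b) (pt c) = D"
  "cevian_trace (pt b) P (pt c) (pt a) = E"
  "cevian_trace (pt c) P (pt a) (pt b) = F"
proof -
  have "join (pt a) P = line (vector [0, - z, y])" "join (pt b) P = line (vector [z, 0, - x])"
    "join (pt c) P = line (vector [- y, x, 0])"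
    unfolding vertex_points using nz by (intro join_eqI; simp add: cross3_def coordinate_simps)+
  then show "cevian_trace (pt a) P (pt b) (pt c) = D" "cevian_trace (pt b) P (pt c) (pt a) = E"
    "cevian_trace (pt c) P (pt a) (pt b) = F"
    unfolding cevian_trace_def join_vertices using nz
    by (simp_all, (intro meet_eqI; simp add: cross3_def coordinate_simps)+)
qed

lemma reflected_trace_points:
  "point_reflection (xmidpoint (pt b) (pt c)) D = D3"
  "point_reflection (xmidpoint (pt c) (pt a)) E = E3"
  "point_reflection (xmidpoint (pt a) (pt b)) F = F3"
proof -
  have refl: "point_reflection (xmidpoint (point u) (point v)) (point w) = point w'"
    if "wt u = 1" "wt v = 1" "w \<noteq> 0" "wt w *\<^sub>R (u + v) - w = w'" for u v w w'
  proof -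
    have "(- 1 * wt (u + v)) *\<^sub>R w + ((1 - - 1) * wt w) *\<^sub>R (u + v) = 2 *\<^sub>R w'"
      unfolding that(4)[symmetric] using that(1,2) by (simp add: vec_eq_iff algebra_simps)
    then show ?thesis
      using homothety_point[of "u + v" w "- 1"] that point_scale[of 2 w']
      by (simp add: point_reflection_def xmidpoint_point)
  qed
  show "point_reflection (xmidpoint (pt b) (pt c)) D = D3"
    "point_reflection (xmidpoint (pt c) (pt a)) E = E3"
    "point_reflection (xmidpoint (pt a) (pt b)) F = F3"
    unfolding vertex_points using nz
    by (intro refl; simp add: vec_eq_iff forall_3)+
qed

lemma isotomic_conjugate: "isotomic_conjugate (pt a) (pt b) (pt c) P = P'"
proof -
  have j: "join (pt a) D3 = line (vector [0, - y, z])" "join (pt b) E3 = line (vector [x, 0, - z])"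
    "join (pt c) F3 = line (vector [- x, y, 0])"
    unfolding vertex_points using nz by (intro join_eqI; simp add: cross3_def coordinate_simps)+
  have nzP: "isotomic_vec x y z \<noteq> 0" using nz by (simp add: coordinate_simps)
  have inter: "line (vector [0, - y, z]) \<inter> line (vector [x, 0, - z]) = {P'}"
    using nz nzP by (intro lines_inter) (simp_all add: cross3_def coordinate_simps)
  have "P' \<in> line (vector [- x, y, 0])" using nzP by (simp add: point_in_line) (simp add: coordinate_simps)
  with inter show ?thesis
    unfolding isotomic_conjugate_def isotomic_trace_def cevian_trace_points reflected_trace_points j
    by (intro the_equality) auto
qed

lemma complements: "complement P' = Q" "complement P = Q'"
proof -
  have "complement_vec (isotomic_vec x y z) = Q_vec x y z"
    "complement_vec (vector [x, y, z]) = cyclic (\<lambda>x y z. y + z) x y z"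
    by (simp_all add: complement_vec_def coordinate_simps)
  moreover have "isotomic_vec x y z \<noteq> 0" "(vector [x, y, z] :: real^3) \<noteq> 0"
    using nz by (simp_all add: coordinate_simps)
  ultimately show "complement P' = Q" "complement P = Q'" using complement_point by metis+
qed

end

locale finite_configuration = cevian_configuration +
  assumes finite_points: "x + y + z \<noteq> 0" "x * y + y * z + z * x \<noteq> 0"
begin

text \<open>The hypotheses are symmetric in \<open>P\<close> and \<open>P'\<close>; through this lemma everything shown for \<open>T\<^sub>P\<close>
  also holds for \<open>T\<^sub>P\<^sub>'\<close>.\<close>

lemma isotomic_finite_configuration: "finite_configuration a b c (y * z) (z * x) (x * y)"
proof unfold_locales
  have "z * x + x * y = x * (y + z)" "x * y + y * z = y * (z + x)" "y * z + z * x = z * (x + y)"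
    by (simp_all add: algebra_simps)
  then show "z * x + x * y \<noteq> 0" "x * y + y * z \<noteq> 0" "y * z + z * x \<noteq> 0" using nz by simp_all
  have "y * z * (z * x) + z * x * (x * y) + x * y * (y * z) = x * y * z * (x + y + z)"
    by (simp add: algebra_simps)
  then show "y * z * (z * x) + z * x * (x * y) + x * y * (y * z) \<noteq> 0" using nz finite_points by simp
  show "y * z + z * x + x * y \<noteq> 0" using finite_points by (simp add: algebra_simps)
qed (use nz in auto)

lemma axis_G1_nonzero: "axis_vec x y z \<bullet> G1_vec x y z \<noteq> 0"
  unfolding axis_G1 using nz finite_points by simp

lemma axis_direction_nonzero: "axis_vec x y z \<bullet> direction_vec x y z \<noteq> 0"
  unfolding axis_direction using nz finite_points by simp

lemma axis_nonzero: "axis_vec x y z \<noteq> 0"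
  using axis_G1_nonzero by auto

lemma Z_nonzero: "Z_vec x y z \<noteq> 0"
  unfolding Z_vec_def using nz by (intro cyclic_nonzero) simp

lemma V_weight: "wt (V_vec x y z) \<noteq> 0"
proof -
  have "wt (V_vec x y z) = (x + y + z) * (x * y + y * z + z * x)"
    by (simp add: V_vec_def cyclic_def power2_eq_square algebra_simps)
  then show ?thesis using finite_points by simp
qed

lemma V_nonzero: "V_vec x y z \<noteq> 0"
  by (rule wt_nonzero[OF V_weight])

lemma direction_nonzero: "direction_vec x y z \<noteq> 0"
  using axis_direction_nonzero by auto

lemma V_eq: "meet (join P Q) (join P' Q') = V"
proof -
  let ?m = "cyclic (\<lambda>x y z. y * z * (y - z)) x y z"
  let ?n = "cyclic (\<lambda>x y z. - (x\<^sup>2 * (y - z))) x y z"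
  have m: "(vector [x, y, z]) \<times> Q_vec x y z = ?m"
    and n: "isotomic_vec x y z \<times> cyclic (\<lambda>x y z. y + z) x y z = ?n"
    by (simp_all add: cross3_def coordinate_simps)
  have "?m \<noteq> 0" "?n \<noteq> 0" using nz by (intro cyclic_nonzero; simp)+
  then have j: "join P Q = line ?m" "join P' Q' = line ?n"
    using join_point[of "vector [x, y, z]" "Q_vec x y z"]
      join_point[of "isotomic_vec x y z" "cyclic (\<lambda>x y z. y + z) x y z"] by (simp_all add: m n)
  have "?m \<times> ?n = ((x - y) * (y - z) * (z - x)) *\<^sub>R V_vec x y z"
    by (simp add: cross3_def coordinate_simps)
  then have "?m \<times> ?n \<noteq> 0" using V_nonzero nz by simp
  then show ?thesis unfolding j
    by (rule meet_eqI[OF _ V_nonzero]) (simp_all add: coordinate_simps)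
qed

lemma V_infinity_eq: "meet (join P P') (join Q Q') = point (direction_vec x y z)"
proof -
  let ?m = "cyclic (\<lambda>x y z. x * ((y + z) * (y - z))) x y z"
  let ?n = "cyclic (\<lambda>x y z. (y - z) * (x + y) * (x + z)) x y z"
  have m: "(vector [x, y, z]) \<times> isotomic_vec x y z = ?m"
    and n: "Q_vec x y z \<times> cyclic (\<lambda>x y z. y + z) x y z = ?n"
    by (simp_all add: cross3_def coordinate_simps)
  have "?m \<noteq> 0" "?n \<noteq> 0" using nz by (intro cyclic_nonzero; simp add: add.commute)+
  then have j: "join P P' = line ?m" "join Q Q' = line ?n"
    using join_point[of "vector [x, y, z]" "isotomic_vec x y z"]
      join_point[of "Q_vec x y z" "cyclic (\<lambda>x y z. y + z) x y z"] by (simp_all add: m n)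
  have "?m \<times> ?n = (- ((x - y) * (y - z) * (z - x))) *\<^sub>R direction_vec x y z"
    by (simp add: cross3_def coordinate_simps)
  then have "?m \<times> ?n \<noteq> 0" using direction_nonzero nz by simp
  then show ?thesis unfolding j
    by (rule meet_eqI[OF _ direction_nonzero]) (simp_all add: coordinate_simps)
qed

lemma join_GV: "join G V = line (axis_vec x y z)"
  using join_point[of "vector [1, 1, 1]" "V_vec x y z"] axis_nonzero line_scale[of "- 1" "axis_vec x y z"]
  by (simp add: axis_cross)

lemma J_eq: "xmidpoint P Q = J"
proof -
  have w: "wt (Q_vec x y z) = 2 * (x * y + y * z + z * x)"
    by (simp add: Q_vec_def cyclic_def algebra_simps)
  have "wt (Q_vec x y z) *\<^sub>R vector [x, y, z] + wt (vector [x, y, z]) *\<^sub>R Q_vec x y z = J_vec x y z"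
    unfolding w by (simp add: coordinate_simps)
  then show ?thesis using xmidpoint_point[of "vector [x, y, z]" "Q_vec x y z"] finite_points
    by (simp add: w)
qed

lemma centroid_DEF: "centroid D E F = G1"
proof -
  have "((x + z) * (x + y)) *\<^sub>R vector [0, y, z] + ((y + z) * (x + y)) *\<^sub>R vector [x, 0, z]
    + ((y + z) * (x + z)) *\<^sub>R vector [x, y, 0] = G1_vec x y z"
    by (simp add: coordinate_simps)
  then show ?thesis
    using centroid_point[of "vector [0, y, z]" "vector [x, 0, z]" "vector [x, y, 0]"] nz
    by (simp add: add.commute)
qed

definition T :: "xpoint \<Rightarrow> xpoint" where
  "T = affine_taking (pt a) (pt b) (pt c) D E F"

lemma T_point:
  assumes "u \<noteq> 0"
  shows "T (point u) = point (cevian_map x y z u)"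
proof -
  let ?d = "(1 / (y + z)) *\<^sub>R vector [0, y, z]"
  let ?e = "(1 / (z + x)) *\<^sub>R vector [x, 0, z]"
  let ?f = "(1 / (x + y)) *\<^sub>R vector [x, y, 0]"
  have "D = point ?d" "E = point ?e" "F = point ?f" using nz by (simp_all add: point_scale)
  moreover have "wt ?d = 1" "wt ?e = 1" "wt ?f = 1" using nz by (simp_all add: add.commute)
  ultimately have "T (point u) = point (u $ 1 *\<^sub>R ?d + u $ 2 *\<^sub>R ?e + u $ 3 *\<^sub>R ?f)"
    using affine_taking_point assms by (simp add: T_def)
  also have "\<dots> = point (((y + z) * (z + x) * (x + y)) *\<^sub>R
      (u $ 1 *\<^sub>R ?d + u $ 2 *\<^sub>R ?e + u $ 3 *\<^sub>R ?f))"
    using nz by (simp add: point_scale)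
  also have "((y + z) * (z + x) * (x + y)) *\<^sub>R (u $ 1 *\<^sub>R ?d + u $ 2 *\<^sub>R ?e + u $ 3 *\<^sub>R ?f)
      = cevian_map x y z u"
    using nz by (simp add: cevian_map_def vec_eq_iff forall_3 divide_simps) (simp add: algebra_simps)
  finally show ?thesis .
qed

lemma T_G: "T G = G1"
  using T_point[of "vector [1, 1, 1]"] cevian_map_G by (simp add: vec_eq_iff forall_3)

text \<open>If \<open>G\<^sub>1\<close> and \<open>Z\<close> were the same point, then \<open>G\<^sub>1\<close> would lie on \<open>GV\<close>.\<close>

lemma G1_cross_Z: "G1_vec x y z \<times> Z_vec x y z \<noteq> 0"
proof
  assume "G1_vec x y z \<times> Z_vec x y z = 0"
  moreover have "G1_vec x y z \<noteq> 0" using axis_G1_nonzero by auto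
  ultimately obtain k where k: "Z_vec x y z = k *\<^sub>R G1_vec x y z"
    using parallel_if_cross_eq_0 by blast
  then have "k = 0" using axis_Z[of x y z] axis_G1_nonzero by simp
  then show False using k Z_nonzero by simp
qed

lemma G1_cross_J: "G1_vec x y z \<times> J_vec x y z \<noteq> 0"
  using G1_cross_Z by (auto simp: Z_eq_G1_J Cross3.right_diff_distrib cross_mult_right)

lemma join_G1_J:
  "join G1 J = line (G1_vec x y z \<times> J_vec x y z)" "join G1 J = join G1 Z"
proof -
  show j: "join G1 J = line (G1_vec x y z \<times> J_vec x y z)" by (rule join_point[OF G1_cross_J])
  have "join G1 Z = line (G1_vec x y z \<times> J_vec x y z)"
    by (rule join_eqI[OF G1_cross_Z G1_cross_J])
      (simp_all add: Z_eq_G1_J inner_diff_right dot_cross_self)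
  then show "join G1 J = join G1 Z" using j by simp
qed

lemma T_axis: "T ` join G V = join G1 J"
proof -
  have lin: "linear (cevian_map x y z)"
    by (rule linearI) (simp_all add: cevian_map_def vec_eq_iff forall_3 algebra_simps)
  let ?k = "(y + z) * (z + x) * (x + y)"
  have cr: "G1_vec x y z \<times> cevian_map x y z (V_vec x y z) = ?k *\<^sub>R (G1_vec x y z \<times> J_vec x y z)"
    by (simp add: cevian_map_V Cross3.right_diff_distrib cross_mult_right)
  then have nzc: "G1_vec x y z \<times> cevian_map x y z (V_vec x y z) \<noteq> 0"
    using G1_cross_J nz by simp
  have "vector [1, 1, 1] \<times> V_vec x y z \<noteq> 0" using axis_nonzero by (simp add: axis_cross)
  then have "T ` join G V = join G1 (point (cevian_map x y z (V_vec x y z)))"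
    using image_join[of T "cevian_map x y z", OF T_point lin] nzc by (simp add: cevian_map_G)
  also have "\<dots> = join G1 J"
    unfolding join_point[OF nzc] join_G1_J(1) cr using nz by (intro line_scale) simp
  finally show ?thesis .
qed

text \<open>The lines are distinct since \<open>l \<times> (G\<^sub>1 \<times> J)\<close> is half of \<open>(l \<bullet> G\<^sub>1) Z\<close>: expand the triple
  product and use that \<open>Z = 3 G\<^sub>1 - 2 J\<close> is orthogonal to \<open>l\<close>.\<close>

lemma axis_inter: "join G V \<inter> join G1 J = {Z}"
  unfolding join_GV join_G1_J(1)
proof (rule lines_inter)
  let ?l = "axis_vec x y z"
  have "2 * (?l \<bullet> J_vec x y z) = 3 * (?l \<bullet> G1_vec x y z)"
    using axis_Z[of x y z] by (simp add: Z_eq_G1_J inner_diff_right)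
  then have "2 *\<^sub>R (?l \<times> (G1_vec x y z \<times> J_vec x y z)) = (?l \<bullet> G1_vec x y z) *\<^sub>R Z_vec x y z"
    unfolding Lagrange Z_eq_G1_J
    by (simp add: scaleR_diff_right) (simp add: algebra_simps)
  then show "?l \<times> (G1_vec x y z \<times> J_vec x y z) \<noteq> 0" using axis_G1_nonzero Z_nonzero by auto
  show "?l \<bullet> Z_vec x y z = 0" by (rule axis_Z)
  show "(G1_vec x y z \<times> J_vec x y z) \<bullet> Z_vec x y z = 0"
    by (simp add: Z_eq_G1_J inner_diff_right dot_cross_self)
qed (rule Z_nonzero)

text \<open>The matrix of the form \<open>2 (f v w + g w u + h u v)\<close>: a zero diagonal makes the conic pass through
  the vertices.\<close>

definition conic_form :: "real^3^3" where
  "conic_form =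
    (let f = x * (y\<^sup>2 - z\<^sup>2); g = y * (z\<^sup>2 - x\<^sup>2); h = z * (x\<^sup>2 - y\<^sup>2)
     in vector [vector [0, h, g], vector [h, 0, f], vector [g, f, 0]])"

lemma squares_differ: "y\<^sup>2 - z\<^sup>2 \<noteq> 0" "z\<^sup>2 - x\<^sup>2 \<noteq> 0" "x\<^sup>2 - y\<^sup>2 \<noteq> 0"
  using nz by (simp_all add: power2_eq_iff add_eq_0_iff add_eq_0_iff2)

lemma conic_form_nondegenerate: "nondegenerate_form conic_form"
proof -
  have "det conic_form = 2 * (x * (y\<^sup>2 - z\<^sup>2)) * (y * (z\<^sup>2 - x\<^sup>2)) * (z * (x\<^sup>2 - y\<^sup>2))"
    by (simp add: conic_form_def Let_def det_3)
  then show ?thesis using squares_differ nz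
    by (simp add: nondegenerate_form_def conic_form_def Let_def vec_eq_iff forall_3 transpose_def)
qed

abbreviation "conic_points \<equiv>
  {vector [1, 0, 0], vector [0, 1, 0], vector [0, 0, 1], vector [x, y, z], Q_vec x y z}"

lemma conic_form_points: "v \<in> conic_points \<Longrightarrow> v \<bullet> (conic_form *v v) = 0"
  by (auto simp: conic_form_def Let_def matrix_vector_mult_def coordinate_simps)

text \<open>Passing through the vertices kills the diagonal of the form. Dividing the remaining entries
  by \<open>x, y, z\<close> makes the condition at \<open>P\<close> say that the quotients \<open>\<alpha>, \<beta>, \<gamma>\<close> have sum zero, and then the
  condition at \<open>Q\<close> fixes their ratio as \<open>y\<^sup>2 - z\<^sup>2 : z\<^sup>2 - x\<^sup>2 : x\<^sup>2 - y\<^sup>2\<close>.\<close>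

lemma conic_form_unique:
  assumes N: "nondegenerate_form N" "\<And>v. v \<in> conic_points \<Longrightarrow> v \<bullet> (N *v v) = 0"
  shows "\<exists>k. N = k *\<^sub>R conic_form"
proof -
  have sym: "N $ i $ j = N $ j $ i" for i j
  proof -
    have "transpose N $ i $ j = N $ i $ j" using N(1) by (simp add: nondegenerate_form_def)
    then show ?thesis by (simp add: transpose_def)
  qed
  have diag: "N $ 1 $ 1 = 0" "N $ 2 $ 2 = 0" "N $ 3 $ 3 = 0"
    using N(2)[of "vector [1, 0, 0]"] N(2)[of "vector [0, 1, 0]"] N(2)[of "vector [0, 0, 1]"]
    by (simp_all add: matrix_vector_mult_def inner_vec_def sum_3)
  define \<alpha> \<beta> \<gamma> where "\<alpha> = N $ 2 $ 3 / x" and "\<beta> = N $ 1 $ 3 / y" and "\<gamma> = N $ 1 $ 2 / z"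
  have entries: "N $ 2 $ 3 = x * \<alpha>" "N $ 1 $ 3 = y * \<beta>" "N $ 1 $ 2 = z * \<gamma>"
    "N $ 3 $ 2 = x * \<alpha>" "N $ 3 $ 1 = y * \<beta>" "N $ 2 $ 1 = z * \<gamma>"
    using nz sym by (simp_all add: \<alpha>_def \<beta>_def \<gamma>_def)
  have form: "v \<bullet> (N *v v) = 2 * (x * \<alpha> * (v $ 2 * v $ 3) + y * \<beta> * (v $ 3 * v $ 1) + z * \<gamma> * (v $ 1 * v $ 2))"
    for v by (simp add: matrix_vector_mult_def inner_vec_def sum_3 diag entries algebra_simps)
  have "x * y * z * (\<alpha> + \<beta> + \<gamma>) = 0"
    using N(2)[of "vector [x, y, z]"] unfolding form by (simp add: algebra_simps)
  then have "\<alpha> + \<beta> + \<gamma> = 0" using nz by simp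
  then have sum0: "\<gamma> = - \<alpha> - \<beta>" by linarith
  have "x * y * z * (\<alpha> * (z + x) * (x + y) + \<beta> * (x + y) * (y + z) + \<gamma> * (y + z) * (z + x)) = 0"
    using N(2)[of "Q_vec x y z"] unfolding form by (simp add: Q_vec_def cyclic_def algebra_simps)
  then have "\<alpha> * (z + x) * (x + y) + \<beta> * (x + y) * (y + z) + \<gamma> * (y + z) * (z + x) = 0"
    using nz by simp
  then have ratio: "\<beta> * (y\<^sup>2 - z\<^sup>2) = \<alpha> * (z\<^sup>2 - x\<^sup>2)"
    unfolding sum0 by (simp add: power2_eq_square algebra_simps)
  define k where "k = \<alpha> / (y\<^sup>2 - z\<^sup>2)"
  have k1: "\<alpha> = k * (y\<^sup>2 - z\<^sup>2)" using squares_differ by (simp add: k_def)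
  have k2: "\<beta> = k * (z\<^sup>2 - x\<^sup>2)" using ratio squares_differ by (simp add: k_def field_simps)
  have k3: "\<gamma> = k * (x\<^sup>2 - y\<^sup>2)" unfolding sum0 k1 k2 by (simp add: algebra_simps)
  have "N = k *\<^sub>R conic_form"
    by (simp add: vec_eq_iff forall_3 conic_form_def Let_def diag entries k1 k2 k3)
  then show ?thesis ..
qed

lemma conic_center_eq: "conic_center (conic_through (pt a) (pt b) (pt c) P Q) = Z"
proof -
  have nonzero: "v \<noteq> 0" if "v \<in> conic_points" for v
  proof -
    have basis: "(vector [1, 0, 0] :: real^3) \<noteq> 0" "(vector [0, 1, 0] :: real^3) \<noteq> 0"
      "(vector [0, 0, 1] :: real^3) \<noteq> 0" "(vector [x, y, z] :: real^3) \<noteq> 0"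
      using nz by (simp_all add: vec_eq_iff forall_3)
    have "Q_vec x y z \<noteq> 0" unfolding Q_vec_def using nz by (intro cyclic_nonzero) simp
    with basis have "\<forall>v \<in> conic_points. v \<noteq> 0" by (simp only: ball_simps simp_thms)
    with that show ?thesis by blast
  qed
  have five: "point ` conic_points = {pt a, pt b, pt c, P, Q}"
    unfolding vertex_points by (simp only: image_insert image_empty)
  have pts: "v \<noteq> 0 \<and> v \<bullet> (conic_form *v v) = 0" if "v \<in> conic_points" for v
    using nonzero[OF that] conic_form_points[OF that] ..
  have polar: "conic_form *v Z_vec x y z =
      (- (2 * x * y * z * ((x - y) * (y - z) * (z - x)))) *\<^sub>R vector [1, 1, 1]"
    by (simp add: conic_form_def Let_def matrix_vector_mult_def coordinate_simps)
  have k: "- (2 * x * y * z * ((x - y) * (y - z) * (z - x))) \<noteq> 0" using nz by simp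
  have "conic_points \<noteq> {}" by simp
  note determined = conic_through_and_center[of conic_form conic_points,
      OF conic_form_nondegenerate _ _ \<open>conic_points \<noteq> {}\<close>]
  have "conic_center (conic conic_form) = Z"
    by (rule determined(2)[OF _ _ polar k]) (fact pts conic_form_unique)+
  moreover have "conic_through (pt a) (pt b) (pt c) P Q = conic conic_form"
    unfolding conic_through_def five[symmetric] by (rule determined(1)) (fact pts conic_form_unique)+
  ultimately show ?thesis by simp
qed

lemma Z_in_joins: "Z \<in> join G V" "Z \<in> join G1 J"
  using axis_inter by auto

text \<open>The claims about \<open>T'\<close> alone are those about \<open>T\<^sub>P\<close> for the isotomic conjugate. For the last one, a
  line is determined by two points: \<open>\<eta>\<close> fixes \<open>Z\<close> and sends \<open>G\<^sub>1\<close> to \<open>G\<^sub>2\<close>.\<close>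

lemma isotomic_cevian_map:
  fixes T' J'
  assumes T': "T' = affine_taking (pt a) (pt b) (pt c) D3 E3 F3" and J': "J' = xmidpoint P' Q'"
  shows "T' ` join G V = join (T' G) J'" "Z \<in> join (T' G) J'"
    "join (T' G) J' = affine_reflection (point (direction_vec x y z)) (join G V) ` join G1 J"
proof -
  interpret isotomic: finite_configuration a b c "y * z" "z * x" "x * y"
    by (rule isotomic_finite_configuration)
  have k: "x * y * z \<noteq> 0" using nz by simp
  have V: "isotomic.V = V" and Z: "isotomic.Z = Z" and Q: "isotomic.Q = Q'"
    unfolding isotomic_scale by (simp_all only: point_scale[OF k])
  have "vector [0, z * x, x * y] = x *\<^sub>R (vector [0, z, y] :: real^3)"
    "vector [y * z, 0, x * y] = y *\<^sub>R (vector [z, 0, x] :: real^3)"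
    "vector [y * z, z * x, 0] = z *\<^sub>R (vector [y, x, 0] :: real^3)"
    by (simp_all add: vec_eq_iff forall_3)
  then have T: "isotomic.T = T'"
    unfolding isotomic.T_def T' by (simp only: point_scale[OF off_sides(1)]
        point_scale[OF off_sides(2)] point_scale[OF off_sides(3)])
  have "vector [y * z, z * x, x * y] = isotomic_vec x y z"
    by (simp add: isotomic_vec_def cyclic_def)
  then have J: "isotomic.J = J'" using isotomic.J_eq by (simp add: Q J')
  have G2: "T' G = isotomic.G1" using isotomic.T_G T by simp
  show "T' ` join G V = join (T' G) J'" using isotomic.T_axis unfolding T V J G2 .
  show "Z \<in> join (T' G) J'" using isotomic.Z_in_joins unfolding Z J G2 by blast
  let ?l = "axis_vec x y z" and ?u = "direction_vec x y z"
  define N where "N w = (?l \<bullet> ?u) *\<^sub>R w - (2 * (?l \<bullet> w)) *\<^sub>R ?u" for w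
  let ?\<eta> = "affine_reflection (point ?u) (join G V)"
  have "wt ?u = 0" by (simp add: direction_vec_def cyclic_def power2_eq_square algebra_simps)
  then have eta: "?\<eta> (point w) = point (N w)" if "w \<noteq> 0" for w
    using affine_reflection_point[OF _ axis_direction_nonzero that] by (simp add: join_GV N_def)
  have lin: "linear N"
    by (rule linearI) (simp_all add: N_def inner_add_right algebra_simps)
  have NG: "(x * y * z) *\<^sub>R N (G1_vec x y z) = (?l \<bullet> ?u) *\<^sub>R G1_vec (y * z) (z * x) (x * y)"
    unfolding isotomic_scale N_def axis_G1 axis_direction
    by (simp add: vec_eq_iff algebra_simps)
  have NZ: "N (Z_vec x y z) = (?l \<bullet> ?u) *\<^sub>R Z_vec x y z" by (simp add: N_def axis_Z)
  have mZ: "(x * y * z) *\<^sub>R N (Z_vec x y z) = (?l \<bullet> ?u) *\<^sub>R Z_vec (y * z) (z * x) (x * y)"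
    unfolding isotomic_scale NZ by (simp add: mult.commute)
  have "((x * y * z) *\<^sub>R N (G1_vec x y z)) \<times> ((x * y * z) *\<^sub>R N (Z_vec x y z)) \<noteq> 0"
    unfolding NG mZ using isotomic.G1_cross_Z axis_direction_nonzero
    by (simp add: cross_mult_left cross_mult_right)
  then have "N (G1_vec x y z) \<times> N (Z_vec x y z) \<noteq> 0"
    by (auto simp: cross_mult_left cross_mult_right)
  moreover have "point (N (G1_vec x y z)) = isotomic.G1"
    using NG k axis_direction_nonzero point_scale by metis
  moreover have "point (N (Z_vec x y z)) = Z"
    using NZ axis_direction_nonzero point_scale by simp
  ultimately have "?\<eta> ` join G1 Z = join isotomic.G1 Z"
    using image_join[of ?\<eta> N, OF eta lin G1_cross_Z] by simp
  then show "join (T' G) J' = ?\<eta> ` join G1 J"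
    using isotomic.join_G1_J(2) join_G1_J(2) by (simp add: G2 Z J)
qed

end

section \<open>The center of the conic\<close>

theorem corollary4p2:
  fixes A B C P P' G D E F D\<^sub>3 E\<^sub>3 F\<^sub>3 Q Q' V Vinf G\<^sub>1 G\<^sub>2 J J' Z :: xpoint
    and K T\<^sub>P T\<^sub>P' \<eta> :: "xpoint \<Rightarrow> xpoint"
    and C\<^sub>P :: "xpoint set"
  assumes vertices: "ordinary A" "ordinary B" "ordinary C"
    and triangle: "\<not> collinear {coords A, coords B, coords C}"
    and G: "G = centroid A B C"
    and K: "K = homothety G (- 1/2)"
    and P: "ordinary P"
    and sides: "P \<notin> join B C" "P \<notin> join C A" "P \<notin> join A B"
    and anticomplementary_sides:
      "P \<notin> join (inv K B) (inv K C)" "P \<notin> join (inv K C) (inv K A)" "P \<notin> join (inv K A) (inv K B)"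
    and medians: "P \<notin> join A G" "P \<notin> join B G" "P \<notin> join C G"
    and P': "P' = isotomic_conjugate A B C P" "ordinary P'"
    and traces:
      "D = cevian_trace A P B C" "E = cevian_trace B P C A" "F = cevian_trace C P A B"
    and reflected_traces:
      "D\<^sub>3 = point_reflection (xmidpoint B C) D"
      "E\<^sub>3 = point_reflection (xmidpoint C A) E"
      "F\<^sub>3 = point_reflection (xmidpoint A B) F"
    and Q: "Q = K P'" "Q' = K P"
    and V: "V = meet (join P Q) (join P' Q')"
    and V_infty: "Vinf = meet (join P P') (join Q Q')"
    and T: "T\<^sub>P = affine_taking A B C D E F" "T\<^sub>P' = affine_taking A B C D\<^sub>3 E\<^sub>3 F\<^sub>3"
    and eta: "\<eta> = affine_reflection Vinf (join G V)"
    and conic: "C\<^sub>P = conic_through A B C P Q"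
    and Z: "Z = conic_center C\<^sub>P"
    and G12: "G\<^sub>1 = T\<^sub>P G" "G\<^sub>2 = T\<^sub>P' G"
    and J: "J = xmidpoint P Q" "J' = xmidpoint P' Q'"
  shows "(G\<^sub>1 = centroid D E F \<and> join G V \<inter> join G\<^sub>1 J = {Z}) \<and>
    (T\<^sub>P ` join G V = join G\<^sub>1 J \<and>
     T\<^sub>P' ` join G V = join G\<^sub>2 J' \<and>
     join G\<^sub>2 J' = \<eta> ` join G\<^sub>1 J \<and>
     Z \<in> join G V \<and> Z \<in> join G\<^sub>1 J \<and> Z \<in> join G\<^sub>2 J')"
proof -
  obtain a b c where abc: "A = pt a" "B = pt b" "C = pt c" using vertices ordinary_iff by metis
  interpret triangle_frame a b c using triangle by unfold_locales (simp add: abc)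
  have G': "G = point (vector [1, 1, 1])" unfolding G abc by (rule centroid_triangle)
  have K': "K = complement" unfolding K G' complement_def ..
  obtain p where p: "p \<noteq> 0" "P = point p" by (rule point_exhaust)
  define x y z where "x = p $ 1" and "y = p $ 2" and "z = p $ 3"
  have p_eq: "p = vector [x, y, z]" by (simp add: x_def y_def z_def vec_eq_iff forall_3)
  have Pxyz: "P = point (vector [x, y, z])" using p p_eq by simp
  have on_line: "P \<in> line m \<longleftrightarrow> m \<bullet> vector [x, y, z] = 0" for m
    using p p_eq point_in_line by simp
  have "join (inv K B) (inv K C) = line (vector [0, 1, 1])"
    "join (inv K C) (inv K A) = line (vector [1, 0, 1])"
    "join (inv K A) (inv K B) = line (vector [1, 1, 0])"
    unfolding K' abc inv_complement by (rule join_eqI; simp add: cross3_def coordinate_simps)+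
  moreover have "join A G = line (vector [0, - 1, 1])" "join B G = line (vector [1, 0, - 1])"
    "join C G = line (vector [- 1, 1, 0])"
    unfolding abc G' vertex_points by (rule join_eqI; simp add: cross3_def coordinate_simps)+
  ultimately interpret cevian_configuration a b c x y z
    using sides anticomplementary_sides medians
    by unfold_locales
      (simp_all add: abc join_vertices on_line inner_vec_def sum_3 add.commute)
  have P'_eq: "P' = point (isotomic_vec x y z)"
    using P' isotomic_conjugate by (simp add: abc Pxyz)
  have "isotomic_vec x y z \<noteq> 0" using nz by (simp add: coordinate_simps)
  then have "wt (isotomic_vec x y z) \<noteq> 0" using P'(2) P'_eq ordinary_point by simp
  moreover have "wt p \<noteq> 0" using P p ordinary_point by simp
  ultimately interpret finite_configuration a b c x y z
    by unfold_locales (simp_all add: p_eq isotomic_vec_def cyclic_def add_ac)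
  have D: "D = point (vector [0, y, z])" "E = point (vector [x, 0, z])" "F = point (vector [x, y, 0])"
    using traces cevian_trace_points by (simp_all add: abc Pxyz)
  have D3: "D\<^sub>3 = point (vector [0, z, y])" "E\<^sub>3 = point (vector [z, 0, x])"
    "F\<^sub>3 = point (vector [y, x, 0])"
    using reflected_traces reflected_trace_points by (simp_all add: abc D)
  have Q_eq: "Q = point (Q_vec x y z)" "Q' = point (cyclic (\<lambda>x y z. y + z) x y z)"
    using Q complements by (simp_all add: K' P'_eq Pxyz)
  have V': "V = point (V_vec x y z)" using V V_eq by (simp add: Pxyz P'_eq Q_eq)
  have Vinf: "Vinf = point (direction_vec x y z)"
    using V_infty V_infinity_eq by (simp add: Pxyz P'_eq Q_eq)
  have T_eq: "T\<^sub>P = local.T" unfolding T(1) abc D T_def ..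
  have G1_eq: "G\<^sub>1 = point (G1_vec x y z)" using T_G by (simp add: G12 T_eq G')
  have J_vec: "J = point (J_vec x y z)" using J J_eq by (simp add: Pxyz Q_eq)
  have Z_eq: "Z = point (Z_vec x y z)"
    using conic_center_eq by (simp add: Z conic abc Pxyz Q_eq)
  note isotomic = isotomic_cevian_map[OF T(2)[unfolded abc D3] J(2)[unfolded P'_eq Q_eq]]
  show ?thesis
    using centroid_DEF axis_inter T_axis Z_in_joins isotomic
    unfolding D G1_eq J_vec Z_eq V' G' T_eq eta Vinf G12(2) by simp
qed

end
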